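(* Let $M$ be a smooth compact manifold, let $f\colon M\to M$ be a $C^1$-local diffeomorphism, let $U\subset M$ be a trapping domain for $f$, and let $\mu$ be an $f$-invariant Borel probability measure supported in $U$. Suppose that the dynamical large deviations principle holds for $(f,\mu,U)$, i.e. for every $\varphi\in C(M)$ and every $\alpha>0$ there exist constants $C=C(\alpha,\varphi)>0$ and $h=h(\alpha,\varphi)>0$ such that $$\forall n\in\mathbb{N}\qquad \mathrm{Leb}(X_{\alpha,\varphi,n}\cap U)\le C e^{-nh}.$$ Then the special ergodic theorem holds for $(f,\mu,U)$, i.e. for every $\varphi\in C(M)$ and every $\alpha>0$ $$\dim_H (X_{\alpha,\varphi}\cap U)<\dim M.$$
   Context: $M$ is equipped with a fixed Riemannian metric, $\mathrm{Leb}$ is the associated volume (Lebesgue) measure, and $\dim_H$ is Hausdorff dimension with respect to the associated distance; $\dim M\ge 1$. $C(M)$ is the space of continuous functions $\varphi\colon M\to\mathbb{R}$. A trapping domain is an open set $U\subset M$ with $f(\overline U)\subset U$; the case $U=M$ is allowed. For $\varphi\in C(M)$, $n\in\mathbb{N}=\{1,2,\dots\}$ and $x\in M$ put $$\varphi_n(x):=\frac1n\sum_{k=0}^{n-1}\varphi(f^k(x)),\qquad \bar\varphi:=\int_M\varphi\,d\mu .$$ For $\alpha>0$ define $$X_{\alpha,\varphi,n}:=\{x\in M:\ |\varphi_n(x)-\bar\varphi|\ge\alpha\},\qquad X_{\alpha,\varphi}:=\Big\{x\in M:\ \limsup_{n\to\infty}|\varphi_n(x)-\bar\varphi|>\alpha\Big\}.$$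 *)

theory Defs
  imports "HOL-Probability.Probability"
begin

text \<open>
  The iterated-derivative predicate is meant for an open set \<open>S\<close> in a finite-dimensional space,
  where it agrees with the usual notion of a \<open>C\<^sup>k\<close> map.
\<close>

fun Ck_on :: "nat \<Rightarrow> 'b::real_normed_vector set \<Rightarrow> ('b \<Rightarrow> 'c::real_normed_vector) \<Rightarrow> bool" where
  "Ck_on 0 S F \<longleftrightarrow> continuous_on S F"
| "Ck_on (Suc k) S F \<longleftrightarrow>
     (\<forall>x\<in>S. F differentiable (at x)) \<and>
     (\<forall>v. Ck_on k S (\<lambda>x. frechet_derivative F (at x) v))"

definition smooth_on :: "'b::real_normed_vector set \<Rightarrow> ('b \<Rightarrow> 'c::real_normed_vector) \<Rightarrow> bool" where
  "smooth_on S F \<longleftrightarrow> (\<forall>k. Ck_on k S F)"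

text \<open>
  The manifold is the whole type \<open>'a\<close>, with the topology of that type, and has dimension
  \<open>CARD('n)\<close>, which is at least \<open>1\<close>. A chart consists of its domain and its coordinate map; the
  values of the coordinate map outside the domain are irrelevant. An atlas need not be maximal.
\<close>

type_synonym ('a, 'n) chart = "'a set \<times> ('a \<Rightarrow> real ^ 'n)"

definition is_chart :: "('a::topological_space, 'n::finite) chart \<Rightarrow> bool" where
  "is_chart c \<longleftrightarrow> open (fst c) \<and> open (snd c ` fst c) \<and>
     (\<exists>\<psi>. homeomorphism (fst c) (snd c ` fst c) (snd c) \<psi>)"

definition chart_inv :: "('a, 'n::finite) chart \<Rightarrow> real ^ 'n \<Rightarrow> 'a" where
  "chart_inv c = inv_into (fst c) (snd c)"

definition transition :: "('a, 'n::finite) chart \<Rightarrow> ('a, 'n) chart \<Rightarrow> real ^ 'n \<Rightarrow> real ^ 'n" where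
  "transition c d = snd d \<circ> chart_inv c"

definition smooth_atlas :: "('a::topological_space, 'n::finite) chart set \<Rightarrow> bool" where
  "smooth_atlas A \<longleftrightarrow>
     (\<forall>c\<in>A. is_chart c) \<and> (\<Union>c\<in>A. fst c) = UNIV \<and>
     (\<forall>c\<in>A. \<forall>d\<in>A. smooth_on (snd c ` (fst c \<inter> fst d)) (transition c d))"

definition C1_map_on ::
  "('a::topological_space, 'n::finite) chart set \<Rightarrow> 'a set \<Rightarrow> ('a \<Rightarrow> 'a) \<Rightarrow> bool" where
  "C1_map_on A V f \<longleftrightarrow> continuous_on V f \<and>
     (\<forall>c\<in>A. \<forall>d\<in>A. Ck_on 1 (snd c ` (V \<inter> fst c \<inter> f -` fst d)) (snd d \<circ> f \<circ> chart_inv c))"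

definition C1_local_diffeo ::
  "('a::topological_space, 'n::finite) chart set \<Rightarrow> ('a \<Rightarrow> 'a) \<Rightarrow> bool" where
  "C1_local_diffeo A f \<longleftrightarrow>
     (\<forall>p. \<exists>V. open V \<and> p \<in> V \<and> open (f ` V) \<and> inj_on f V \<and>
          C1_map_on A V f \<and> C1_map_on A (f ` V) (inv_into V f))"

text \<open>
  A Riemannian metric is given by its local representatives: \<open>g c p u v\<close> is the inner product of
  the two tangent vectors at \<open>p\<close> whose coordinates in the chart \<open>c\<close> are \<open>u\<close> and \<open>v\<close>. The last
  condition says that the representatives define the same form on the tangent space at \<open>p\<close>.
\<close>

type_synonym ('a, 'n) metric_rep =
  "('a, 'n) chart \<Rightarrow> 'a \<Rightarrow> real ^ 'n \<Rightarrow> real ^ 'n \<Rightarrow> real"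

definition riemannian_metric ::
  "('a::topological_space, 'n::finite) chart set \<Rightarrow> ('a, 'n) metric_rep \<Rightarrow> bool" where
  "riemannian_metric A g \<longleftrightarrow>
     (\<forall>c\<in>A. \<forall>p\<in>fst c. bilinear (g c p) \<and> (\<forall>u v. g c p u v = g c p v u) \<and>
                        (\<forall>v. v \<noteq> 0 \<longrightarrow> g c p v v > 0)) \<and>
     (\<forall>c\<in>A. \<forall>u v. smooth_on (snd c ` fst c) (\<lambda>x. g c (chart_inv c x) u v)) \<and>
     (\<forall>c\<in>A. \<forall>d\<in>A. \<forall>p\<in>fst c \<inter> fst d. \<forall>u v.
        g d p (frechet_derivative (transition c d) (at (snd c p)) u)
              (frechet_derivative (transition c d) (at (snd c p)) v) = g c p u v)"

text \<open>One-sided derivatives are used at the end points of \<open>{a..b}\<close>.\<close>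

definition C1_curve_on ::
  "('a::topological_space, 'n::finite) chart set \<Rightarrow> real \<Rightarrow> real \<Rightarrow> (real \<Rightarrow> 'a) \<Rightarrow> bool" where
  "C1_curve_on A a b \<gamma> \<longleftrightarrow> continuous_on {a..b} \<gamma> \<and>
     (\<forall>c\<in>A. \<exists>\<gamma>'.
        (\<forall>t\<in>{a..b} \<inter> \<gamma> -` fst c. ((snd c \<circ> \<gamma>) has_vector_derivative \<gamma>' t) (at t within {a..b})) \<and>
        continuous_on ({a..b} \<inter> \<gamma> -` fst c) \<gamma>')"

definition piecewise_C1_curve ::
  "('a::topological_space, 'n::finite) chart set \<Rightarrow> (real \<Rightarrow> 'a) \<Rightarrow> bool" where
  "piecewise_C1_curve A \<gamma> \<longleftrightarrow> continuous_on {0..1} \<gamma> \<and>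
     (\<exists>S. finite S \<and>
        (\<forall>a b. 0 \<le> a \<and> a < b \<and> b \<le> 1 \<and> {a<..<b} \<inter> S = {} \<longrightarrow> C1_curve_on A a b \<gamma>))"

text \<open>
  The speed does not depend on the chosen chart; it is meaningful except at the finitely many
  corners and the two end points, which do not affect the length.
\<close>

definition chart_at :: "('a, 'n::finite) chart set \<Rightarrow> 'a \<Rightarrow> ('a, 'n) chart" where
  "chart_at A p = (SOME c. c \<in> A \<and> p \<in> fst c)"

definition curve_speed ::
  "('a, 'n::finite) chart set \<Rightarrow> ('a, 'n) metric_rep \<Rightarrow> (real \<Rightarrow> 'a) \<Rightarrow> real \<Rightarrow> real" where
  "curve_speed A g \<gamma> t =
     (let c = chart_at A (\<gamma> t); w = vector_derivative (snd c \<circ> \<gamma>) (at t)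
      in sqrt (g c (\<gamma> t) w w))"

definition curve_length ::
  "('a, 'n::finite) chart set \<Rightarrow> ('a, 'n) metric_rep \<Rightarrow> (real \<Rightarrow> 'a) \<Rightarrow> ennreal" where
  "curve_length A g \<gamma> = (\<integral>\<^sup>+ t\<in>{0..1}. ennreal (curve_speed A g \<gamma> t) \<partial>lborel)"

text \<open>Points in different components have distance \<open>\<infinity>\<close>, the infimum of the empty set.\<close>

definition riemannian_dist ::
  "('a::topological_space, 'n::finite) chart set \<Rightarrow> ('a, 'n) metric_rep \<Rightarrow> 'a \<Rightarrow> 'a \<Rightarrow> ennreal" where
  "riemannian_dist A g p q =
     (INF \<gamma>\<in>{\<gamma>. piecewise_C1_curve A \<gamma> \<and> \<gamma> 0 = p \<and> \<gamma> 1 = q}. curve_length A g \<gamma>)"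

definition volume_density ::
  "('a, 'n::finite) metric_rep \<Rightarrow> ('a, 'n) chart \<Rightarrow> real ^ 'n \<Rightarrow> real" where
  "volume_density g c x = sqrt (det (\<chi> i j. g c (chart_inv c x) (axis i 1) (axis j 1)))"

text \<open>
  The Riemannian volume is the unique Borel measure given by \<open>sqrt (det g) dx\<close> in every chart.
\<close>

definition riemannian_volume ::
  "('a::topological_space, 'n::finite) chart set \<Rightarrow> ('a, 'n) metric_rep \<Rightarrow> 'a measure \<Rightarrow> bool" where
  "riemannian_volume A g Leb \<longleftrightarrow> sets Leb = sets borel \<and>
     (\<forall>c\<in>A. \<forall>E\<in>sets borel. E \<subseteq> fst c \<longrightarrow>
        emeasure Leb E = (\<integral>\<^sup>+ x\<in>snd c ` E. ennreal (volume_density g c x) \<partial>lborel))"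

definition diam :: "('a \<Rightarrow> 'a \<Rightarrow> ennreal) \<Rightarrow> 'a set \<Rightarrow> ennreal" where
  "diam d S = (SUP x\<in>S. SUP y\<in>S. d x y)"

text \<open>
  Only exponents \<open>s > 0\<close> are used, which avoids the convention for \<open>0\<^sup>0\<close> and does not affect the
  dimension. The diameters in the sum are finite.
\<close>

definition hausdorff_pre :: "('a \<Rightarrow> 'a \<Rightarrow> ennreal) \<Rightarrow> real \<Rightarrow> real \<Rightarrow> 'a set \<Rightarrow> ennreal" where
  "hausdorff_pre d s \<delta> E =
     (INF S\<in>{S :: nat \<Rightarrow> 'a set. E \<subseteq> (\<Union>i. S i) \<and> (\<forall>i. diam d (S i) \<le> ennreal \<delta>)}.
        \<Sum>i. ennreal (enn2real (diam d (S i)) powr s))"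

definition hausdorff_measure :: "('a \<Rightarrow> 'a \<Rightarrow> ennreal) \<Rightarrow> real \<Rightarrow> 'a set \<Rightarrow> ennreal" where
  "hausdorff_measure d s E = (SUP \<delta>\<in>{0<..}. hausdorff_pre d s \<delta> E)"

definition hausdorff_dim :: "('a \<Rightarrow> 'a \<Rightarrow> ennreal) \<Rightarrow> 'a set \<Rightarrow> ennreal" where
  "hausdorff_dim d E = (INF s\<in>{s. 0 < s \<and> hausdorff_measure d s E = 0}. ennreal s)"

definition trapping_domain :: "('a::topological_space \<Rightarrow> 'a) \<Rightarrow> 'a set \<Rightarrow> bool" where
  "trapping_domain f U \<longleftrightarrow> open U \<and> f ` closure U \<subseteq> U"

definition invariant_borel_prob :: "('a::topological_space \<Rightarrow> 'a) \<Rightarrow> 'a measure \<Rightarrow> bool" where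
  "invariant_borel_prob f \<mu> \<longleftrightarrow>
     prob_space \<mu> \<and> sets \<mu> = sets borel \<and> f \<in> measurable \<mu> \<mu> \<and> distr \<mu> \<mu> f = \<mu>"

definition birkhoff_avg :: "('a \<Rightarrow> 'a) \<Rightarrow> ('a \<Rightarrow> real) \<Rightarrow> nat \<Rightarrow> 'a \<Rightarrow> real" where
  "birkhoff_avg f \<phi> n x = (\<Sum>k<n. \<phi> ((f ^^ k) x)) / real n"

definition deviation_set ::
  "('a \<Rightarrow> 'a) \<Rightarrow> 'a measure \<Rightarrow> real \<Rightarrow> ('a \<Rightarrow> real) \<Rightarrow> nat \<Rightarrow> 'a set" where
  "deviation_set f \<mu> \<alpha> \<phi> n = {x. \<bar>birkhoff_avg f \<phi> n x - (\<integral>y. \<phi> y \<partial>\<mu>)\<bar> \<ge> \<alpha>}"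

definition limsup_deviation_set ::
  "('a \<Rightarrow> 'a) \<Rightarrow> 'a measure \<Rightarrow> real \<Rightarrow> ('a \<Rightarrow> real) \<Rightarrow> 'a set" where
  "limsup_deviation_set f \<mu> \<alpha> \<phi> =
     {x. limsup (\<lambda>n. ereal \<bar>birkhoff_avg f \<phi> n x - (\<integral>y. \<phi> y \<partial>\<mu>)\<bar>) > ereal \<alpha>}"

definition large_deviations ::
  "'a::topological_space measure \<Rightarrow> ('a \<Rightarrow> 'a) \<Rightarrow> 'a measure \<Rightarrow> 'a set \<Rightarrow> bool" where
  "large_deviations Leb f \<mu> U \<longleftrightarrow>
     (\<forall>\<phi>. continuous_on UNIV \<phi> \<longrightarrow> (\<forall>\<alpha>>0. \<exists>C>0. \<exists>h>0. \<forall>n\<ge>1.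
        emeasure Leb (deviation_set f \<mu> \<alpha> \<phi> n \<inter> U) \<le> ennreal (C * exp (- (real n * h)))))"

definition special_ergodic ::
  "('a::topological_space, 'n::finite) chart set \<Rightarrow> ('a, 'n) metric_rep \<Rightarrow>
   ('a \<Rightarrow> 'a) \<Rightarrow> 'a measure \<Rightarrow> 'a set \<Rightarrow> bool" where
  "special_ergodic A g f \<mu> U \<longleftrightarrow>
     (\<forall>\<phi>. continuous_on UNIV \<phi> \<longrightarrow> (\<forall>\<alpha>>0.
        hausdorff_dim (riemannian_dist A g) (limsup_deviation_set f \<mu> \<alpha> \<phi> \<inter> U)
          < of_nat CARD('n)))"

end

theory Submission imports Defs begin

text \<open>
  If \<open>x \<in> U\<close> has an \<open>\<alpha>\<close>-deviation at time \<open>n\<close>, then every point within distance \<open>r L\<^sup>-\<^sup>n\<close> of \<open>x\<close>,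
  where \<open>L\<close> is a Lipschitz constant of \<open>f\<close>, still has an \<open>\<alpha>/2\<close>-deviation. Since the volume of
  the latter points decays like \<open>e\<^sup>-\<^sup>n\<^sup>h\<close>, at most a constant times \<open>L\<^sup>n\<^sup>N e\<^sup>-\<^sup>n\<^sup>h\<close> cubes of side
  \<open>r L\<^sup>-\<^sup>n\<close> are needed at time \<open>n\<close>, with \<open>N = dim M\<close>. Their total \<open>s\<close>-dimensional size is summable
  over \<open>n\<close> as soon as \<open>(N - s) ln L < h\<close>, which holds for some \<open>s < N\<close>. The boundary of \<open>U\<close> does no
  harm because this exponent does not depend on the location: the open set \<open>U\<close> is exhausted by
  countably many coordinate balls whose doubles lie in \<open>U\<close>.
\<close>

subsection \<open>Null sets of Hausdorff measures\<close>

lemma hausdorff_pre_le_countable: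
  fixes S :: "'i::countable \<Rightarrow> 'a set"
  assumes "E \<subseteq> (\<Union>i. S i)" "\<And>i. diam d (S i) \<le> ennreal \<delta>"
  shows "hausdorff_pre d s \<delta> E
    \<le> (\<integral>\<^sup>+i. ennreal (enn2real (diam d (S i)) powr s) \<partial>count_space UNIV)"
proof -
  define T where "T n = (if n \<in> range (to_nat :: 'i \<Rightarrow> nat) then S (from_nat n) else {})" for n
  have T: "T (to_nat i) = S i" for i by (simp add: T_def)
  have "diam d (T n) \<le> ennreal \<delta>" for n
    using assms(2) by (auto simp: T_def diam_def)
  moreover have "E \<subseteq> (\<Union>n. T n)" using assms(1) T by blast
  ultimately have "hausdorff_pre d s \<delta> E \<le> (\<Sum>n. ennreal (enn2real (diam d (T n)) powr s))"
    unfolding hausdorff_pre_def by (intro INF_lower) auto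
  also have "\<dots> = (\<integral>\<^sup>+n. ennreal (enn2real (diam d (T n)) powr s) \<partial>count_space UNIV)"
    by (simp add: nn_integral_count_space_nat)
  also have "\<dots> = (\<integral>\<^sup>+n. ennreal (enn2real (diam d (T n)) powr s)
      * indicator (range (to_nat :: 'i \<Rightarrow> nat)) n \<partial>count_space UNIV)"
    by (intro nn_integral_cong) (auto simp: T_def diam_def bot_ennreal split: split_indicator)
  also have "\<dots> = (\<integral>\<^sup>+n. ennreal (enn2real (diam d (T n)) powr s)
      \<partial>count_space (range (to_nat :: 'i \<Rightarrow> nat)))"
    by (subst nn_integral_count_space_indicator) auto
  also have "\<dots> = (\<integral>\<^sup>+i. ennreal (enn2real (diam d (T (to_nat i))) powr s)
      \<partial>count_space (UNIV :: 'i set))"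
    by (intro nn_integral_bij_count_space[symmetric]) (simp add: bij_betw_def)
  finally show ?thesis by (simp add: T)
qed

lemma hausdorff_measure_eq_0_iff:
  "hausdorff_measure d s E = 0 \<longleftrightarrow> (\<forall>\<delta>>0. hausdorff_pre d s \<delta> E = 0)"
  unfolding hausdorff_measure_def bot_ennreal[symmetric] SUP_bot_conv by auto

lemma hausdorff_pre_mono: "E \<subseteq> F \<Longrightarrow> hausdorff_pre d s \<delta> E \<le> hausdorff_pre d s \<delta> F"
  unfolding hausdorff_pre_def by (intro INF_superset_mono) auto

text \<open>Covers of the n-th set with sum below \<open>\<epsilon> * (1/2)^Suc n\<close> combine
  into one cover of the union, indexed by pairs, with sum at most \<open>\<epsilon>\<close>.\<close>

lemma hausdorff_measure_zero_UN:
  fixes E :: "nat \<Rightarrow> 'a set"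
  assumes "\<And>n. hausdorff_measure d s (E n) = 0"
  shows "hausdorff_measure d s (\<Union>n. E n) = 0"
  unfolding hausdorff_measure_eq_0_iff
proof (intro allI impI)
  fix \<delta> :: real assume \<delta>: "\<delta> > 0"
  have "hausdorff_pre d s \<delta> (\<Union>n. E n) \<le> 0 + ennreal \<epsilon>" if \<epsilon>: "\<epsilon> > 0" for \<epsilon>
  proof -
    have "\<exists>S::nat \<Rightarrow> 'a set. E n \<subseteq> (\<Union>i. S i) \<and> (\<forall>i. diam d (S i) \<le> ennreal \<delta>) \<and>
        (\<Sum>i. ennreal (enn2real (diam d (S i)) powr s)) < ennreal (\<epsilon> * (1/2)^Suc n)" for n
    proof -
      have "hausdorff_pre d s \<delta> (E n) < ennreal (\<epsilon> * (1/2)^Suc n)"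
        using assms[of n] \<delta> \<epsilon> unfolding hausdorff_measure_eq_0_iff by auto
      then show ?thesis unfolding hausdorff_pre_def INF_less_iff by auto
    qed
    then obtain S :: "nat \<Rightarrow> nat \<Rightarrow> 'a set" where
      S: "\<And>n. E n \<subseteq> (\<Union>i. S n i)" "\<And>n i. diam d (S n i) \<le> ennreal \<delta>"
         "\<And>n. (\<Sum>i. ennreal (enn2real (diam d (S n i)) powr s)) < ennreal (\<epsilon> * (1/2)^Suc n)"
      by metis
    have "hausdorff_pre d s \<delta> (\<Union>n. E n)
       \<le> (\<integral>\<^sup>+q. ennreal (enn2real (diam d (case_prod S q)) powr s) \<partial>count_space UNIV)"
      using S(1,2) by (intro hausdorff_pre_le_countable) (auto split: prod.splits, fast)
    also have "\<dots> = (\<integral>\<^sup>+n. \<integral>\<^sup>+i. ennreal (enn2real (diam d (S n i)) powr s) \<partial>count_space UNIV \<partial>count_space UNIV)"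
      by (subst nn_integral_fst_count_space[symmetric]) simp
    also have "\<dots> = (\<Sum>n. \<Sum>i. ennreal (enn2real (diam d (S n i)) powr s))"
      by (simp add: nn_integral_count_space_nat)
    also have "\<dots> \<le> (\<Sum>n. ennreal (\<epsilon> * (1/2)^Suc n))"
      using S(3) by (intro suminf_le) (auto intro: less_imp_le)
    also have "\<dots> = ennreal \<epsilon>"
      using sums_mult[OF power_half_series, of \<epsilon>] \<epsilon> by (intro suminf_ennreal_eq) auto
    finally show ?thesis by simp
  qed
  then have "hausdorff_pre d s \<delta> (\<Union>n. E n) \<le> 0" by (rule ennreal_le_epsilon)
  then show "hausdorff_pre d s \<delta> (\<Union>n. E n) = 0" by simp
qed

lemma hausdorff_measure_zero_mono:
  "hausdorff_measure d s F = 0 \<Longrightarrow> E \<subseteq> F \<Longrightarrow> hausdorff_measure d s E = 0"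
  unfolding hausdorff_measure_eq_0_iff
  by (auto dest: hausdorff_pre_mono[of E F d s] simp flip: le_zero_eq intro: order_trans)

text \<open>By Lindelof, countably many of the open sets \<open>W\<close> already cover
  \<open>E\<close>. This lets the constants of the later estimate depend on the point, as long as
  the exponent \<open>s\<close> does not.\<close>

lemma hausdorff_measure_zero_local:
  fixes E :: "'a::second_countable_topology set"
  assumes "\<And>p. p \<in> E \<Longrightarrow> \<exists>W. open W \<and> p \<in> W \<and> hausdorff_measure d s (E \<inter> W) = 0"
  shows "hausdorff_measure d s E = 0"
proof -
  define \<F> where "\<F> = {W. open W \<and> hausdorff_measure d s (E \<inter> W) = 0}"
  obtain \<G> where \<G>: "\<G> \<subseteq> \<F>" "countable \<G>" "\<Union>\<G> = \<Union>\<F>"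
    using Lindelof[of \<F>] by (auto simp: \<F>_def)
  have "E \<subseteq> \<Union>\<G>" using assms unfolding \<G>(3) by (auto simp: \<F>_def)
  show ?thesis
  \<comment> \<open>\<open>from_nat_into\<close> enumerates only nonempty families. An empty family
    forces \<open>E\<close> to be empty, and then a cover by empty sets gives the value 0.\<close>
  proof (cases "\<G> = {}")
    case True
    then have "E = {}" using \<open>E \<subseteq> \<Union>\<G>\<close> by auto
    have "hausdorff_pre d s \<delta> {} \<le> (\<integral>\<^sup>+(i::nat). ennreal (enn2real (diam d {}) powr s) \<partial>count_space UNIV)"
      for \<delta>
      by (rule hausdorff_pre_le_countable) (auto simp: diam_def)
    then show ?thesis unfolding hausdorff_measure_eq_0_iff \<open>E = {}\<close>
      by (simp add: diam_def bot_ennreal)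
  next
    case False
    have "hausdorff_measure d s (\<Union>n. E \<inter> from_nat_into \<G> n) = 0"
      using from_nat_into[OF False] \<G>(1) by (intro hausdorff_measure_zero_UN) (auto simp: \<F>_def)
    moreover have "E \<subseteq> (\<Union>n. E \<inter> from_nat_into \<G> n)"
      using \<open>E \<subseteq> \<Union>\<G>\<close> range_from_nat_into[OF False \<G>(2)] by blast
    ultimately show ?thesis by (rule hausdorff_measure_zero_mono)
  qed
qed

subsection \<open>Charts and local Lipschitz bounds\<close>

lemma Ck_on_1D:
  assumes "Ck_on 1 S F"
  shows "x \<in> S \<Longrightarrow> (F has_derivative frechet_derivative F (at x)) (at x)"
    and "continuous_on S (\<lambda>x. frechet_derivative F (at x) v)"
  using assms by (auto simp: frechet_derivative_works)

text \<open>\<open>Ck_on\<close> gives continuity of the derivative one direction at a time. On a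
  compact ball each basis direction has a bounded derivative, the sum of these bounds dominates the
  operator norm, and convexity of the ball gives the mean value inequality.\<close>

lemma Ck_on_1_locally_Lipschitz:
  fixes F :: "'b::euclidean_space \<Rightarrow> 'c::real_normed_vector"
  assumes F: "Ck_on 1 S F" and "open S" "x \<in> S"
  obtains r B where "r > 0" "B \<ge> 0" "ball x r \<subseteq> S"
    "\<And>y z. y \<in> ball x r \<Longrightarrow> z \<in> ball x r \<Longrightarrow> norm (F y - F z) \<le> B * norm (y - z)"
proof -
  obtain r where r: "r > 0" "cball x r \<subseteq> S"
    using \<open>open S\<close> \<open>x \<in> S\<close> open_contains_cball by blast
  let ?D = "\<lambda>y. frechet_derivative F (at y)"
  have "\<exists>K. \<forall>y\<in>cball x r. norm (?D y b) \<le> K" for b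
  proof -
    have "compact ((\<lambda>y. ?D y b) ` cball x r)"
      using continuous_on_subset[OF Ck_on_1D(2)[OF F] r(2)] by (intro compact_continuous_image) auto
    then show ?thesis by (force dest!: compact_imp_bounded simp: bounded_iff)
  qed
  then obtain K where K: "\<And>b y. y \<in> cball x r \<Longrightarrow> norm (?D y b) \<le> K b" by metis
  have K0: "K b \<ge> 0" for b using K[of x b] r by (smt (verit) centre_in_cball norm_ge_zero)
  let ?B = "\<Sum>b\<in>Basis. K b"
  have on: "onorm (?D y) \<le> ?B" if y: "y \<in> cball x r" for y
  proof (rule onorm_bound)
    fix v
    have lin: "linear (?D y)"
      using Ck_on_1D(1)[OF F] y r has_derivative_bounded_linear bounded_linear.linear by blast
    have "?D y (\<Sum>b\<in>Basis. (v \<bullet> b) *\<^sub>R b) = (\<Sum>b\<in>Basis. (v \<bullet> b) *\<^sub>R ?D y b)"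
      by (simp only: linear_sum[OF lin] linear_cmul[OF lin])
    then have "?D y v = (\<Sum>b\<in>Basis. (v \<bullet> b) *\<^sub>R ?D y b)"
      by (simp only: euclidean_representation)
    also have "norm \<dots> \<le> (\<Sum>b\<in>Basis. norm v * K b)"
      using K[OF y] Basis_le_norm[of _ v] by (intro sum_norm_le) (simp add: mult_mono)
    finally show "norm (?D y v) \<le> ?B * norm v"
      by (simp add: sum_distrib_left mult.commute)
  qed (use K0 in \<open>auto intro: sum_nonneg\<close>)
  have "norm (F y - F z) \<le> ?B * norm (y - z)" if "y \<in> ball x r" "z \<in> ball x r" for y z
  proof (rule differentiable_bound[OF convex_ball[of x r]])
    fix w assume w: "w \<in> ball x r"
    then have "w \<in> S" using r(2) by auto
    then show "(F has_derivative ?D w) (at w within ball x r)"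
      by (rule has_derivative_at_withinI[OF Ck_on_1D(1)[OF F]])
    show "onorm (?D w) \<le> ?B" using w by (intro on subsetD[OF ball_subset_cball])
  qed (use that in auto)
  moreover have "?B \<ge> 0" using K0 by (rule sum_nonneg)
  moreover have "ball x r \<subseteq> S" using r(2) ball_subset_cball by blast
  ultimately show ?thesis using that r(1) by blast
qed

section \<open>Chart domains, coordinate maps and their inverses\<close>

context
  fixes c :: "('a::topological_space, 'n::finite) chart"
  assumes c: "is_chart c"
begin

lemma chart_inj: "inj_on (snd c) (fst c)"
  using c unfolding is_chart_def homeomorphism_def by (metis inj_on_inverseI)

lemma chart_inv_left: "x \<in> fst c \<Longrightarrow> chart_inv c (snd c x) = x"
  unfolding chart_inv_def using chart_inj by simp

lemma chart_inv_right: "y \<in> snd c ` fst c \<Longrightarrow> snd c (chart_inv c y) = y"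
  unfolding chart_inv_def by (rule f_inv_into_f)

lemma chart_inv_mem: "y \<in> snd c ` fst c \<Longrightarrow> chart_inv c y \<in> fst c"
  unfolding chart_inv_def by (rule inv_into_into)

lemma continuous_on_chart: "continuous_on (fst c) (snd c)"
  using c unfolding is_chart_def homeomorphism_def by blast

text \<open>The inverse in \<open>is_chart\<close> is only asserted to exist; it agrees with
  \<open>chart_inv\<close> on the coordinate image, which makes \<open>chart_inv\<close> continuous
  there.\<close>

lemma homeomorphism_chart: "homeomorphism (fst c) (snd c ` fst c) (snd c) (chart_inv c)"
proof -
  obtain \<psi> where \<psi>: "homeomorphism (fst c) (snd c ` fst c) (snd c) \<psi>"
    using c unfolding is_chart_def by blast
  have "\<psi> y = chart_inv c y" if "y \<in> snd c ` fst c" for y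
    using \<psi> that chart_inv_left unfolding homeomorphism_def by auto
  then have "continuous_on (snd c ` fst c) (chart_inv c)"
    using \<psi> unfolding homeomorphism_def by (metis continuous_on_cong)
  then show ?thesis
    by (intro homeomorphismI continuous_on_chart)
       (auto simp: chart_inv_left chart_inv_right chart_inv_mem)
qed

lemma continuous_on_chart_inv: "continuous_on (snd c ` fst c) (chart_inv c)"
  using homeomorphism_chart unfolding homeomorphism_def by blast

lemma open_chart_domain: "open (fst c)" and open_chart_range: "open (snd c ` fst c)"
  using c unfolding is_chart_def by auto

lemma open_chart_image: "open W \<Longrightarrow> W \<subseteq> fst c \<Longrightarrow> open (snd c ` W)"
  using homeomorphism_imp_open_map[OF homeomorphism_chart, of W] open_chart_domain open_chart_range
  by (simp add: openin_open_eq)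

lemma open_chart_vimage: "open B \<Longrightarrow> open (fst c \<inter> snd c -` B)"
  using continuous_open_preimage continuous_on_chart open_chart_domain by blast

end

lemma smooth_atlasD:
  assumes "smooth_atlas A"
  shows "c \<in> A \<Longrightarrow> is_chart c" and "\<exists>c\<in>A. p \<in> fst c"
    and "c \<in> A \<Longrightarrow> d \<in> A \<Longrightarrow> Ck_on k (snd c ` (fst c \<inter> fst d)) (transition c d)"
  using assms unfolding smooth_atlas_def smooth_on_def by blast+

lemma C1_local_diffeo_continuous:
  assumes "C1_local_diffeo A f"
  shows "continuous_on UNIV f"
proof -
  let ?\<V> = "{V. open V \<and> continuous_on V f}"
  have "\<Union>?\<V> = UNIV"
    using assms unfolding C1_local_diffeo_def C1_map_on_def by blast
  moreover have "continuous_on (\<Union>?\<V>) f" by (rule continuous_on_open_Union) auto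
  ultimately show ?thesis by (simp only:)
qed

text \<open>The coordinate representative of \<open>f\<close> is C^1 near \<open>snd c p\<close>,
  hence Lipschitz on a small ball. A second radius keeps the images inside \<open>W\<close>, which
  is a coordinate ball of the target chart when the lemma is applied.\<close>

lemma C1_local_diffeo_chart_Lipschitz:
  fixes A :: "('a::topological_space, 'n::finite) chart set"
  assumes A: "smooth_atlas A" and f: "C1_local_diffeo A f"
    and cd: "c \<in> A" "d \<in> A" and W: "open W" "W \<subseteq> fst d" and p: "p \<in> fst c" "f p \<in> W"
  obtains r B where "r > 0" "B \<ge> 0" "ball (snd c p) r \<subseteq> snd c ` fst c"
    "\<And>x. x \<in> fst c \<Longrightarrow> snd c x \<in> ball (snd c p) r \<Longrightarrow> f x \<in> W"
    "\<And>x y. x \<in> fst c \<Longrightarrow> y \<in> fst c \<Longrightarrow> snd c x \<in> ball (snd c p) r \<Longrightarrow>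
      snd c y \<in> ball (snd c p) r \<Longrightarrow>
      norm (snd d (f x) - snd d (f y)) \<le> B * norm (snd c x - snd c y)"
proof -
  note ch = smooth_atlasD(1)[OF A cd(1)]
  obtain V where V: "open V" "p \<in> V" "C1_map_on A V f"
    using f unfolding C1_local_diffeo_def by meson
  let ?S = "snd c ` (V \<inter> fst c \<inter> f -` fst d)"
  let ?T = "snd c ` (V \<inter> fst c \<inter> f -` W)"
  let ?F = "snd d \<circ> f \<circ> chart_inv c"
  have F: "Ck_on 1 ?S ?F" using V cd unfolding C1_map_on_def by blast
  have op: "open (f -` X)" if "open X" for X
    using that C1_local_diffeo_continuous[OF f] by (simp add: continuous_on_open_vimage)
  have oS: "open ?S"
    using V op open_chart_domain[OF ch] open_chart_domain[OF smooth_atlasD(1)[OF A cd(2)]]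
    by (intro open_chart_image[OF ch] open_Int) auto
  have oT: "open ?T"
    using V op W open_chart_domain[OF ch] by (intro open_chart_image[OF ch] open_Int) auto
  have pT: "snd c p \<in> ?T" using V p by auto
  then have "snd c p \<in> ?S" using W by auto
  from Ck_on_1_locally_Lipschitz[OF F oS this]
  obtain r B where r: "r > 0" "B \<ge> 0"
    and Lip: "\<And>y z. y \<in> ball (snd c p) r \<Longrightarrow> z \<in> ball (snd c p) r \<Longrightarrow> norm (?F y - ?F z) \<le> B * norm (y - z)"
    by metis
  obtain r' where r': "r' > 0" "ball (snd c p) r' \<subseteq> ?T"
    using oT pT open_contains_ball by blast
  \<comment> \<open>By injectivity of the chart on its domain, membership can be read off from the
    coordinates.\<close>
  have mem: "x \<in> V \<inter> fst c \<inter> f -` W" if x: "x \<in> fst c" "snd c x \<in> ball (snd c p) r'" for x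
  proof -
    obtain z where "z \<in> V \<inter> fst c \<inter> f -` W" "snd c x = snd c z" using x(2) r' by blast
    then show ?thesis using inj_onD[OF chart_inj[OF ch]] x(1) by blast
  qed
  show ?thesis
  proof (rule that[of "min r r'" B])
    show "norm (snd d (f x) - snd d (f y)) \<le> B * norm (snd c x - snd c y)"
      if "x \<in> fst c" "y \<in> fst c" "snd c x \<in> ball (snd c p) (min r r')"
        "snd c y \<in> ball (snd c p) (min r r')" for x y
      using Lip[of "snd c x" "snd c y"] that by (simp add: chart_inv_left[OF ch])
  qed (use r r' mem in auto)
qed

subsection \<open>Separation of orbits\<close>

lemma finite_positive_lower_bound:
  fixes r :: "'i \<Rightarrow> real"
  assumes "finite I" "\<And>i. i \<in> I \<Longrightarrow> r i > 0"
  obtains r0 where "r0 > 0" "\<And>i. i \<in> I \<Longrightarrow> r0 \<le> r i"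
proof
  show "Min (insert 1 (r ` I)) > 0" using assms by auto
  show "Min (insert 1 (r ` I)) \<le> r i" if "i \<in> I" for i using that assms by simp
qed

text \<open>The added element 2 makes the bound exceed 1 even for an empty family; the expansion
  constant must satisfy \<open>L > 1\<close> so that \<open>ln L\<close> is positive and the powers
  of \<open>L\<close> grow.\<close>

lemma finite_upper_bound:
  fixes B :: "'i \<Rightarrow> real"
  assumes "finite I"
  obtains B0 where "B0 > 1" "\<And>i. i \<in> I \<Longrightarrow> B i \<le> B0"
proof
  show "Max (insert 2 (B ` I)) > 1" using assms by (simp add: Max_gr_iff)
  show "B i \<le> Max (insert 2 (B ` I))" if "i \<in> I" for i using that assms by simp
qed

definition chart_ball :: "('a, 'n::finite) chart \<Rightarrow> 'a \<Rightarrow> real \<Rightarrow> 'a set" where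
  "chart_ball c p R = fst c \<inter> snd c -` ball (snd c p) R"

lemma open_chart_ball: "is_chart c \<Longrightarrow> open (chart_ball c p R)"
  unfolding chart_ball_def by (rule open_chart_vimage) auto

text \<open>Closed balls inside the coordinate images are compact sets on which constants can be
  chosen uniformly in each chart; finiteness of \<open>P\<close> then makes them uniform on the
  whole manifold.\<close>

lemma finite_chart_ball_cover:
  fixes A :: "('a::topological_space, 'n::finite) chart set"
  assumes "compact (UNIV :: 'a set)" and A: "smooth_atlas A"
  obtains P c R where "finite (P :: 'a set)" "\<And>p. c p \<in> A"
    "\<And>p. cball (snd (c p) p) (R p) \<subseteq> snd (c p) ` fst (c p)"
    "(\<Union>p\<in>P. chart_ball (c p) p (R p)) = UNIV"
proof -
  have "\<exists>c R. c \<in> A \<and> p \<in> fst c \<and> R > 0 \<and> cball (snd c p) R \<subseteq> snd c ` fst c" for p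
  proof -
    obtain c where c: "c \<in> A" "p \<in> fst c" using smooth_atlasD(2)[OF A] by blast
    then show ?thesis
      using open_chart_range[OF smooth_atlasD(1)[OF A c(1)]]
      by (meson imageI open_contains_cball)
  qed
  then obtain c R where cR: "\<And>p. c p \<in> A" "\<And>p. p \<in> fst (c p)" "\<And>p. R p > 0"
    "\<And>p. cball (snd (c p) p) (R p) \<subseteq> snd (c p) ` fst (c p)"
    by metis
  have "open (chart_ball (c p) p (R p))" for p
    using open_chart_ball smooth_atlasD(1)[OF A cR(1)] by blast
  moreover have "UNIV \<subseteq> (\<Union>p\<in>UNIV. chart_ball (c p) p (R p))"
    using cR(2,3) by (auto simp: chart_ball_def)
  ultimately obtain P where "finite P" "UNIV \<subseteq> (\<Union>p\<in>P. chart_ball (c p) p (R p))"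
    using compactE_image[OF assms(1), of UNIV "\<lambda>p. chart_ball (c p) p (R p)"] by metis
  then show ?thesis using that[of P c R] cR by blast
qed

text \<open>
  The orbits of \<open>x\<close> and \<open>y\<close> are compared through charts from a fixed finite family, which
  plays the role of a metric on the manifold.
\<close>

definition chart_close ::
  "'a set \<Rightarrow> ('a \<Rightarrow> ('a, 'n::finite) chart) \<Rightarrow> ('a \<Rightarrow> real) \<Rightarrow> real \<Rightarrow> 'a \<Rightarrow> 'a \<Rightarrow> bool" where
  "chart_close P c R \<rho> x y \<longleftrightarrow> (\<exists>p\<in>P. x \<in> chart_ball (c p) p (R p) \<and> y \<in> chart_ball (c p) p (R p) \<and>
     norm (snd (c p) x - snd (c p) y) \<le> \<rho>)"

context
  fixes A :: "('a::topological_space, 'n::finite) chart set" and f :: "'a \<Rightarrow> 'a"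
    and P c R
  assumes A: "smooth_atlas A"
    and f: "C1_local_diffeo A f"
    and P: "finite P"
    and c: "\<And>p. c p \<in> A"
    and R: "\<And>p. cball (snd (c p) p) (R p) \<subseteq> snd (c p) ` fst (c p)"
    and cover: "(\<Union>p\<in>P. chart_ball (c p) p (R p)) = UNIV"
begin

text \<open>A Lebesgue number argument in the closed coordinate ball. Near each of its points
  \<open>f\<close> is Lipschitz into one fixed target chart; two points that are close enough lie in
  a common such neighbourhood, so their images are compared in a single chart.\<close>

lemma chart_close_step_at:
  obtains L r where "r > 0"
    "\<And>\<rho> x y. \<lbrakk>x \<in> chart_ball (c p) p (R p); y \<in> chart_ball (c p) p (R p);
       norm (snd (c p) x - snd (c p) y) \<le> \<rho>; \<rho> \<le> r\<rbrakk> \<Longrightarrow> chart_close P c R (L * \<rho>) (f x) (f y)"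
proof -
  let ?c = "c p" and ?K = "cball (snd (c p) p) (R p)"
  note ch = smooth_atlasD(1)[OF A c]
  \<comment> \<open>\<open>G\<close> bundles the radius, the Lipschitz constant and the target chart
    at \<open>z\<close>, so that all three can be chosen at once as functions of
    \<open>z\<close>.\<close>
  define G where "G z r B q \<longleftrightarrow> r > 0 \<and> B \<ge> 0 \<and> q \<in> P \<and>
      (\<forall>x\<in>fst ?c. snd ?c x \<in> ball z r \<longrightarrow> f x \<in> chart_ball (c q) q (R q)) \<and>
      (\<forall>x\<in>fst ?c. \<forall>y\<in>fst ?c. snd ?c x \<in> ball z r \<longrightarrow> snd ?c y \<in> ball z r \<longrightarrow>
        norm (snd (c q) (f x) - snd (c q) (f y)) \<le> B * norm (snd ?c x - snd ?c y))"
    for z and r B :: real and q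
  have "\<exists>r B q. G z r B q" if z: "z \<in> ?K" for z
  proof -
    let ?x = "chart_inv ?c z"
    have x: "?x \<in> fst ?c" "snd ?c ?x = z"
      using z R[of p] chart_inv_mem[OF ch] chart_inv_right[OF ch] by blast+
    obtain q where q: "q \<in> P" "f ?x \<in> chart_ball (c q) q (R q)" using cover by blast
    have "chart_ball (c q) q (R q) \<subseteq> fst (c q)" by (auto simp: chart_ball_def)
    from C1_local_diffeo_chart_Lipschitz[OF A f c[of p] c[of q]
        open_chart_ball[OF smooth_atlasD(1)[OF A c]] this x(1) q(2)]
    show ?thesis
      using q(1) unfolding x(2) G_def by (metis (no_types, lifting))
  qed
  then obtain r B q where G: "\<And>z. z \<in> ?K \<Longrightarrow> G z (r z) (B z) (q z)" by metis
  have r: "r z > 0" and B: "B z \<ge> 0" and q: "q z \<in> P"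
    and fq: "\<And>x. x \<in> fst ?c \<Longrightarrow> snd ?c x \<in> ball z (r z) \<Longrightarrow>
      f x \<in> chart_ball (c (q z)) (q z) (R (q z))"
    and Lip: "\<And>x y. x \<in> fst ?c \<Longrightarrow> y \<in> fst ?c \<Longrightarrow> snd ?c x \<in> ball z (r z) \<Longrightarrow>
      snd ?c y \<in> ball z (r z) \<Longrightarrow>
      norm (snd (c (q z)) (f x) - snd (c (q z)) (f y)) \<le> B z * norm (snd ?c x - snd ?c y)"
    if "z \<in> ?K" for z
    using G[OF that] unfolding G_def by blast+
  \<comment> \<open>Halved radii leave room: if \<open>x\<close> lies in a half ball, every
    \<open>y\<close> within less than half the radius of \<open>x\<close> lies in the full
    ball.\<close>
  have "?K \<subseteq> (\<Union>z\<in>?K. ball z (r z / 2))" using r by force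
  then obtain Z where Z: "Z \<subseteq> ?K" "finite Z" "?K \<subseteq> (\<Union>z\<in>Z. ball z (r z / 2))"
    using compactE_image[of ?K ?K "\<lambda>z. ball z (r z / 2)"] by auto
  \<comment> \<open>A third is strictly less than a half, which turns the non-strict bound on the
    coordinate distance into the strict one needed for open balls.\<close>
  obtain r0 where r0: "r0 > 0" "\<And>z. z \<in> Z \<Longrightarrow> r0 \<le> r z / 3"
    using finite_positive_lower_bound[of Z "\<lambda>z. r z / 3"] Z r by (auto simp: subset_iff)
  obtain L where L: "L > 1" "\<And>z. z \<in> Z \<Longrightarrow> B z \<le> L"
    using finite_upper_bound[OF Z(2)] by metis
  show ?thesis
  proof (rule that[of r0 L, OF r0(1)])
    fix \<rho> x y
    assume x: "x \<in> chart_ball ?c p (R p)" and y: "y \<in> chart_ball ?c p (R p)"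
      and xy: "norm (snd ?c x - snd ?c y) \<le> \<rho>" and \<rho>: "\<rho> \<le> r0"
    have "snd ?c x \<in> ?K" using x by (auto simp: chart_ball_def)
    then obtain z where z: "z \<in> Z" "snd ?c x \<in> ball z (r z / 2)" using Z(3) by blast
    then have zK: "z \<in> ?K" using Z(1) by blast
    have "r0 \<le> r z / 3" using r0(2) z(1) .
    then have "dist (snd ?c x) (snd ?c y) < r z / 2"
      using r[OF zK] xy \<rho> by (simp add: dist_norm)
    then have "snd ?c x \<in> ball z (r z)" "snd ?c y \<in> ball z (r z)"
      using z(2) dist_triangle_half_l[of z "snd ?c x" "r z" "snd ?c y"] r[OF zK]
        dist_triangle[of z "snd ?c y" "snd ?c x"]
      by (auto simp: mem_ball)
    moreover have "x \<in> fst ?c" "y \<in> fst ?c" using x y by (auto simp: chart_ball_def)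
    moreover have "B z * norm (snd ?c x - snd ?c y) \<le> L * \<rho>"
      using B[OF zK] L(2)[OF z(1)] xy by (intro mult_mono) auto
    ultimately show "chart_close P c R (L * \<rho>) (f x) (f y)"
      unfolding chart_close_def
      by (intro bexI[OF _ q[OF zK]] conjI fq[OF zK] order_trans[OF Lip[OF zK]])
  qed
qed

lemma chart_close_mono: "chart_close P c R \<rho> x y \<Longrightarrow> \<rho> \<le> \<rho>' \<Longrightarrow> chart_close P c R \<rho>' x y"
  unfolding chart_close_def by (meson order_trans)

lemma chart_close_nonneg: "chart_close P c R \<rho> x y \<Longrightarrow> \<rho> \<ge> 0"
  unfolding chart_close_def using norm_ge_zero order_trans by blast

text \<open>Take the smallest radius and the largest Lipschitz constant over the finitely many
  charts. The resulting \<open>L\<close> serves as a global Lipschitz constant of \<open>f\<close>,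
  although the chart may change at each step.\<close>

lemma chart_close_step:
  obtains L r where "L > 1" "r > 0"
    "\<And>\<rho> x y. chart_close P c R \<rho> x y \<Longrightarrow> \<rho> \<le> r \<Longrightarrow> chart_close P c R (L * \<rho>) (f x) (f y)"
proof -
  have "\<forall>p. \<exists>L r. r > 0 \<and> (\<forall>\<rho> x y. x \<in> chart_ball (c p) p (R p) \<longrightarrow> y \<in> chart_ball (c p) p (R p) \<longrightarrow>
       norm (snd (c p) x - snd (c p) y) \<le> \<rho> \<longrightarrow> \<rho> \<le> r \<longrightarrow> chart_close P c R (L * \<rho>) (f x) (f y))"
    by (metis chart_close_step_at)
  then obtain L r where r: "\<And>p. r p > 0"
    and step: "\<And>p \<rho> x y. \<lbrakk>x \<in> chart_ball (c p) p (R p); y \<in> chart_ball (c p) p (R p);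
       norm (snd (c p) x - snd (c p) y) \<le> \<rho>; \<rho> \<le> r p\<rbrakk> \<Longrightarrow> chart_close P c R (L p * \<rho>) (f x) (f y)"
    by metis
  obtain r0 where r0: "r0 > 0" "\<And>p. p \<in> P \<Longrightarrow> r0 \<le> r p"
    using finite_positive_lower_bound[OF P, of r] r by blast
  obtain L0 where L0: "L0 > 1" "\<And>p. p \<in> P \<Longrightarrow> L p \<le> L0"
    using finite_upper_bound[OF P, of L] by blast
  show ?thesis
  proof (rule that[OF L0(1) r0(1)])
    fix \<rho> x y assume cl: "chart_close P c R \<rho> x y" and \<rho>: "\<rho> \<le> r0"
    then obtain p where p: "p \<in> P" "x \<in> chart_ball (c p) p (R p)" "y \<in> chart_ball (c p) p (R p)"
       "norm (snd (c p) x - snd (c p) y) \<le> \<rho>" unfolding chart_close_def by blast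
    have "chart_close P c R (L p * \<rho>) (f x) (f y)"
      using step[OF p(2-4)] r0(2)[OF p(1)] \<rho> by linarith
    then show "chart_close P c R (L0 * \<rho>) (f x) (f y)"
      using L0(2)[OF p(1)] chart_close_nonneg[OF cl] by (elim chart_close_mono) (rule mult_right_mono)
  qed
qed

text \<open>Uniform continuity of \<open>\<phi>\<close> read in each compact coordinate ball, with
  the smallest of the finitely many radii.\<close>

lemma chart_close_continuous:
  fixes \<phi> :: "'a \<Rightarrow> real"
  assumes \<phi>: "continuous_on UNIV \<phi>" and \<epsilon>: "\<epsilon> > 0"
  obtains r where "r > 0" "\<And>\<rho> x y. chart_close P c R \<rho> x y \<Longrightarrow> \<rho> \<le> r \<Longrightarrow> \<bar>\<phi> x - \<phi> y\<bar> \<le> \<epsilon>"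
proof -
  have "\<exists>r>0. \<forall>x\<in>chart_ball (c p) p (R p). \<forall>y\<in>chart_ball (c p) p (R p).
      norm (snd (c p) x - snd (c p) y) \<le> r \<longrightarrow> \<bar>\<phi> x - \<phi> y\<bar> \<le> \<epsilon>" for p
  proof -
    note ch = smooth_atlasD(1)[OF A c[of p]]
    let ?K = "cball (snd (c p) p) (R p)"
    have "continuous_on ?K (\<phi> \<circ> chart_inv (c p))"
      using continuous_on_subset[OF continuous_on_chart_inv[OF ch] R]
        continuous_on_subset[OF \<phi>] by (intro continuous_on_compose) auto
    then have "uniformly_continuous_on ?K (\<phi> \<circ> chart_inv (c p))"
      by (rule compact_uniformly_continuous) auto
    then obtain r where r: "r > 0" "\<And>z w. z \<in> ?K \<Longrightarrow> w \<in> ?K \<Longrightarrow> dist w z < r \<Longrightarrow>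
        dist ((\<phi> \<circ> chart_inv (c p)) w) ((\<phi> \<circ> chart_inv (c p)) z) < \<epsilon>"
      using \<epsilon> unfolding uniformly_continuous_on_def by metis
    \<comment> \<open>Uniform continuity requires a strict bound, closeness offers a non-strict one,
      hence \<open>r / 2\<close>.\<close>
    have "\<bar>\<phi> x - \<phi> y\<bar> \<le> \<epsilon>" if "x \<in> chart_ball (c p) p (R p)" "y \<in> chart_ball (c p) p (R p)"
      "norm (snd (c p) x - snd (c p) y) \<le> r / 2" for x y
    proof -
      have "snd (c p) x \<in> ?K" "snd (c p) y \<in> ?K" "x \<in> fst (c p)" "y \<in> fst (c p)"
        using that by (auto simp: chart_ball_def)
      then show ?thesis
        using r(2)[of "snd (c p) y" "snd (c p) x"] that(3) r(1)
        by (simp add: dist_norm chart_inv_left[OF ch])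
    qed
    then show ?thesis using r(1) by (intro exI[of _ "r/2"]) auto
  qed
  then obtain r where r: "\<And>p. r p > 0" "\<And>p x y. x \<in> chart_ball (c p) p (R p) \<Longrightarrow>
    y \<in> chart_ball (c p) p (R p) \<Longrightarrow> norm (snd (c p) x - snd (c p) y) \<le> r p \<Longrightarrow> \<bar>\<phi> x - \<phi> y\<bar> \<le> \<epsilon>"
    by metis
  obtain r0 where r0: "r0 > 0" "\<And>p. p \<in> P \<Longrightarrow> r0 \<le> r p"
    using finite_positive_lower_bound[OF P, of r] r by blast
  show ?thesis
  proof (rule that[OF r0(1)])
    fix \<rho> x y assume "chart_close P c R \<rho> x y" "\<rho> \<le> r0"
    then obtain p where p: "p \<in> P" "x \<in> chart_ball (c p) p (R p)" "y \<in> chart_ball (c p) p (R p)"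
       "norm (snd (c p) x - snd (c p) y) \<le> \<rho>" unfolding chart_close_def by blast
    then show "\<bar>\<phi> x - \<phi> y\<bar> \<le> \<epsilon>" using r(2)[OF p(2,3)] r0(2)[OF p(1)] \<open>\<rho> \<le> r0\<close> by linarith
  qed
qed

end

text \<open>Closeness grows at most by the factor \<open>L\<close> per step, so an initial
  coordinate distance of at most \<open>r / L ^ n\<close> leads to closeness at most
  \<open>r\<close> up to time \<open>n\<close>. Only the starting chart appears in the conclusion;
  \<open>L\<close> and \<open>r\<close> do not depend on \<open>p\<close>, and \<open>V\<close> does
  not depend on \<open>n\<close>.\<close>

lemma orbits_stay_close:
  fixes A :: "('a::topological_space, 'n::finite) chart set" and \<phi> :: "'a \<Rightarrow> real"
  assumes "compact (UNIV :: 'a set)" and A: "smooth_atlas A" and f: "C1_local_diffeo A f"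
    and \<phi>: "continuous_on UNIV \<phi>" and \<epsilon>: "\<epsilon> > 0"
  obtains L r where "L > 1" "r > 0"
    "\<And>p. \<exists>c\<in>A. \<exists>V. open V \<and> p \<in> V \<and> V \<subseteq> fst c \<and>
       (\<forall>n k. \<forall>x\<in>V. \<forall>y\<in>V. norm (snd c x - snd c y) * L ^ n \<le> r \<longrightarrow> k \<le> n \<longrightarrow>
          \<bar>\<phi> ((f ^^ k) x) - \<phi> ((f ^^ k) y)\<bar> \<le> \<epsilon>)"
proof -
  obtain P c R where P: "finite P" and c: "\<And>p. c p \<in> A"
    and R: "\<And>p. cball (snd (c p) p) (R p) \<subseteq> snd (c p) ` fst (c p)"
    and cover: "(\<Union>p\<in>P. chart_ball (c p) p (R p)) = UNIV"
    by (rule finite_chart_ball_cover[OF assms(1) A]) (rule that)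
  note ctx = A f P c R cover
  obtain L r1 where L: "L > 1" "r1 > 0"
    and step: "\<And>\<rho> x y. chart_close P c R \<rho> x y \<Longrightarrow> \<rho> \<le> r1 \<Longrightarrow> chart_close P c R (L * \<rho>) (f x) (f y)"
    by (rule chart_close_step[OF ctx]) (rule that)
  obtain r2 where r2: "r2 > 0"
    "\<And>\<rho> x y. chart_close P c R \<rho> x y \<Longrightarrow> \<rho> \<le> r2 \<Longrightarrow> \<bar>\<phi> x - \<phi> y\<bar> \<le> \<epsilon>"
    by (rule chart_close_continuous[OF ctx \<phi> \<epsilon>]) (rule that)
  \<comment> \<open>\<open>r1\<close> keeps every step within the range of the Lipschitz estimate,
    \<open>r2\<close> controls the variation of \<open>\<phi>\<close>.\<close>
  let ?r = "min r1 r2"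
  have iter: "chart_close P c R (L ^ k * \<rho>) ((f ^^ k) x) ((f ^^ k) y)"
    if "chart_close P c R \<rho> x y" "L ^ n * \<rho> \<le> ?r" "k \<le> n" for \<rho> x y n k
    using that(3)
  proof (induction k)
    case (Suc k)
    \<comment> \<open>Since \<open>L > 1\<close>, the bound at the final time \<open>n\<close>
      covers all earlier times.\<close>
    have "L ^ k * \<rho> \<le> L ^ n * \<rho>"
      using Suc.prems L(1) chart_close_nonneg[OF ctx that(1)]
      by (intro mult_right_mono power_increasing) auto
    then have "chart_close P c R (L * (L ^ k * \<rho>)) (f ((f ^^ k) x)) (f ((f ^^ k) y))"
      using Suc that(2) by (intro step) auto
    then show ?case by (simp add: mult.assoc)
  qed (use that in simp)
  show ?thesis
  proof (rule that[of L ?r])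
    fix p
    obtain q where q: "q \<in> P" "p \<in> chart_ball (c q) q (R q)" using cover by blast
    have "\<bar>\<phi> ((f ^^ k) x) - \<phi> ((f ^^ k) y)\<bar> \<le> \<epsilon>"
      if xy: "x \<in> chart_ball (c q) q (R q)" "y \<in> chart_ball (c q) q (R q)"
        and n: "norm (snd (c q) x - snd (c q) y) * L ^ n \<le> ?r" "k \<le> n" for n k x y
    proof (rule r2(2)[OF iter])
      let ?\<rho> = "norm (snd (c q) x - snd (c q) y)"
      show "chart_close P c R ?\<rho> x y"
        using q(1) xy unfolding chart_close_def by blast
      show n': "L ^ n * ?\<rho> \<le> ?r" using n(1) by (simp add: mult.commute)
      have "L ^ k * ?\<rho> \<le> L ^ n * ?\<rho>"
        using n(2) L(1) by (intro mult_right_mono power_increasing) auto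
      then show "L ^ k * ?\<rho> \<le> r2" using n' by linarith
    qed (fact n(2))
    then show "\<exists>c\<in>A. \<exists>V. open V \<and> p \<in> V \<and> V \<subseteq> fst c \<and>
       (\<forall>n k. \<forall>x\<in>V. \<forall>y\<in>V. norm (snd c x - snd c y) * L ^ n \<le> ?r \<longrightarrow> k \<le> n \<longrightarrow>
          \<bar>\<phi> ((f ^^ k) x) - \<phi> ((f ^^ k) y)\<bar> \<le> \<epsilon>)"
      using q open_chart_ball[OF smooth_atlasD(1)[OF A c[of q]]]
      by (intro bexI[OF _ c[of q]] exI[of _ "chart_ball (c q) q (R q)"])
         (auto simp: chart_ball_def)
  qed (use L r2 in auto)
qed

subsection \<open>Riemannian distance and volume in a chart\<close>

lemma bilinear_axis_expansion:
  fixes B :: "real^'n \<Rightarrow> real^'n \<Rightarrow> real"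
  assumes "bilinear B"
  shows "B u v = (\<Sum>i\<in>UNIV. \<Sum>j\<in>UNIV. u $ i * v $ j * B (axis i 1) (axis j 1))"
proof -
  have l: "linear (\<lambda>u. B u v)" "linear (\<lambda>v. B u v)" for u v
    using assms unfolding bilinear_def by auto
  have e: "(\<Sum>i\<in>UNIV. w $ i *\<^sub>R axis i 1) = w" for w :: "real^'n"
    using basis_expansion[of w] by (simp add: scalar_mult_eq_scaleR)
  have "B u v = B (\<Sum>i\<in>UNIV. u $ i *\<^sub>R axis i 1) v" by (simp only: e)
  also have "\<dots> = (\<Sum>i\<in>UNIV. u $ i * B (axis i 1) v)"
    by (simp only: linear_sum[OF l(1)] linear_cmul[OF l(1)] real_scaleR_def)
  also have "\<dots> = (\<Sum>i\<in>UNIV. u $ i * B (axis i 1) (\<Sum>j\<in>UNIV. v $ j *\<^sub>R axis j 1))"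
    by (simp only: e)
  also have "\<dots> = (\<Sum>i\<in>UNIV. \<Sum>j\<in>UNIV. u $ i * v $ j * B (axis i 1) (axis j 1))"
    by (simp only: linear_sum[OF l(2)] linear_cmul[OF l(2)] real_scaleR_def sum_distrib_left mult.assoc)
  finally show ?thesis .
qed

text \<open>The determinant does not vanish along the segment from the identity matrix to \<open>G\<close>.\<close>

lemma det_pos_if_positive_definite:
  fixes G :: "real^'n^'n"
  assumes pos: "\<And>v. v \<noteq> 0 \<Longrightarrow> v \<bullet> (G *v v) > 0"
  shows "det G > 0"
proof (rule ccontr)
  assume "\<not> det G > 0"
  define M where "M t = (1 - t) *\<^sub>R mat 1 + t *\<^sub>R G" for t :: real
  have "continuous_on {0..1} (\<lambda>t. det (M t))"
    unfolding det_def M_def by (intro continuous_intros)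
  moreover have "det (M 0) = 1" "det (M 1) = det G" by (auto simp: M_def)
  ultimately obtain t where t: "0 \<le> t" "t \<le> 1" "det (M t) = 0"
    using IVT2'[of "\<lambda>t. det (M t)" 1 0 0] \<open>\<not> det G > 0\<close> by auto
  then obtain v where v: "v \<noteq> 0" "M t *v v = 0"
    using invertible_det_nz[of "M t"] matrix_left_invertible_ker[of "M t"]
    by (auto simp: invertible_left_inverse)
  have "0 = v \<bullet> (M t *v v)" using v by simp
  also have "\<dots> = (1 - t) * (v \<bullet> v) + t * (v \<bullet> (G *v v))"
    by (simp add: M_def matrix_vector_mult_add_rdistrib inner_add_right scaleR_matrix_vector_assoc[symmetric])
  finally have "0 = (1 - t) * (v \<bullet> v) + t * (v \<bullet> (G *v v))" .
  moreover have "(1 - t) * (v \<bullet> v) + t * (v \<bullet> (G *v v)) > 0"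
  \<comment> \<open>At \<open>t = 1\<close> the first summand vanishes and positivity has to come
    from \<open>G\<close>; for \<open>t < 1\<close> it comes from the identity part.\<close>
  proof (cases "t = 1")
    case False
    then have "(1 - t) * (v \<bullet> v) > 0" using t v by simp
    moreover have "t * (v \<bullet> (G *v v)) \<ge> 0" using t pos[OF v(1)] by simp
    ultimately show ?thesis by linarith
  qed (use pos[OF v(1)] in simp)
  ultimately show False by simp
qed

context
  fixes A :: "('a::topological_space, 'n::finite) chart set" and g :: "('a, 'n) metric_rep"
    and c :: "('a, 'n) chart"
  assumes A: "smooth_atlas A" and g: "riemannian_metric A g" and c: "c \<in> A"
begin

lemma metric_bilinear: "p \<in> fst c \<Longrightarrow> bilinear (g c p)"
  and metric_pos: "p \<in> fst c \<Longrightarrow> v \<noteq> 0 \<Longrightarrow> g c p v v > 0"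
  using g c unfolding riemannian_metric_def by blast+

lemma metric_continuous: "continuous_on (snd c ` fst c) (\<lambda>x. g c (chart_inv c x) u v)"
proof -
  have "smooth_on (snd c ` fst c) (\<lambda>x. g c (chart_inv c x) u v)"
    using g c unfolding riemannian_metric_def by blast
  then have "Ck_on 0 (snd c ` fst c) (\<lambda>x. g c (chart_inv c x) u v)"
    unfolding smooth_on_def by blast
  then show ?thesis by simp
qed

lemma metric_transform:
  "d \<in> A \<Longrightarrow> p \<in> fst c \<Longrightarrow> p \<in> fst d \<Longrightarrow>
    g d p (frechet_derivative (transition c d) (at (snd c p)) u)
          (frechet_derivative (transition c d) (at (snd c p)) v) = g c p u v"
  using g c unfolding riemannian_metric_def by blast

text \<open>The Gram matrix in the coordinate basis represents the metric at the point, hence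
  inherits its positive definiteness.\<close>

lemma volume_density_pos:
  assumes "x \<in> snd c ` fst c"
  shows "volume_density g c x > 0"
proof -
  let ?p = "chart_inv c x"
  have p: "?p \<in> fst c" using chart_inv_mem[OF smooth_atlasD(1)[OF A c] assms] .
  have "det (\<chi> i j. g c ?p (axis i 1) (axis j 1)) > 0"
  proof (rule det_pos_if_positive_definite)
    fix v :: "real^'n" assume v: "v \<noteq> 0"
    have "g c ?p v v = (\<Sum>i\<in>UNIV. \<Sum>j\<in>UNIV. v $ i * v $ j * g c ?p (axis i 1) (axis j 1))"
      by (rule bilinear_axis_expansion[OF metric_bilinear[OF p]])
    also have "\<dots> = v \<bullet> ((\<chi> i j. g c ?p (axis i 1) (axis j 1)) *v v)"
      by (simp add: inner_vec_def matrix_vector_mult_def sum_distrib_left algebra_simps)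
    finally show "v \<bullet> ((\<chi> i j. g c ?p (axis i 1) (axis j 1)) *v v) > 0"
      using metric_pos[OF p v] by simp
  qed
  then show ?thesis unfolding volume_density_def by simp
qed

text \<open>A positive continuous function is bounded away from 0 on a compact set. The bound
  \<open>a\<close> later turns the Lebesgue measure of a cube into a lower bound for its Riemannian
  volume.\<close>

lemma volume_density_lower_bound:
  assumes "compact K" "K \<subseteq> snd c ` fst c"
  obtains a where "a > 0" "\<And>x. x \<in> K \<Longrightarrow> a \<le> volume_density g c x"
proof (cases "K = {}")
  case True
  then show ?thesis using that[of 1] by simp
next
  case False
  have "continuous_on K (volume_density g c)"
    unfolding volume_density_def det_def
    by (auto intro!: continuous_intros continuous_on_subset[OF metric_continuous assms(2)])
  then obtain x where "x \<in> K" "\<And>y. y \<in> K \<Longrightarrow> volume_density g c x \<le> volume_density g c y"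
    using continuous_attains_inf[OF assms(1) False] by blast
  then show ?thesis using that[of "volume_density g c x"] volume_density_pos assms(2) by blast
qed

text \<open>The Gram matrix entries are bounded on \<open>K\<close>, and each coordinate of
  \<open>v\<close> is at most \<open>norm v\<close> in absolute value.\<close>

lemma metric_upper_bound:
  assumes "compact K" "K \<subseteq> snd c ` fst c"
  obtains B where "B > 0" "\<And>x v. x \<in> K \<Longrightarrow> sqrt (g c (chart_inv c x) v v) \<le> B * norm v"
proof -
  have "\<exists>b. \<forall>x\<in>K. \<bar>g c (chart_inv c x) u v\<bar> \<le> b" for u v
  proof -
    have "compact ((\<lambda>x. g c (chart_inv c x) u v) ` K)"
      using continuous_on_subset[OF metric_continuous assms(2)] assms(1)
      by (rule compact_continuous_image)
    then show ?thesis by (force dest!: compact_imp_bounded simp: bounded_iff)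
  qed
  then obtain b where b: "\<And>u v x. x \<in> K \<Longrightarrow> \<bar>g c (chart_inv c x) u v\<bar> \<le> b u v"
    by metis
  let ?b = "\<Sum>i\<in>UNIV. \<Sum>j\<in>UNIV. \<bar>b (axis i 1) (axis j 1)\<bar>"
  have b0: "?b \<ge> 0" by (intro sum_nonneg) auto
  \<comment> \<open>Adding 1 makes the constant positive, since the sum of the bounds is only known
    to be nonnegative.\<close>
  have "sqrt (g c (chart_inv c x) v v) \<le> sqrt (?b + 1) * norm v" if x: "x \<in> K" for x v
  proof -
    let ?p = "chart_inv c x"
    have "?p \<in> fst c" using chart_inv_mem[OF smooth_atlasD(1)[OF A c]] x assms(2) by blast
    then have "g c ?p v v = (\<Sum>i\<in>UNIV. \<Sum>j\<in>UNIV. v $ i * v $ j * g c ?p (axis i 1) (axis j 1))"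
      by (intro bilinear_axis_expansion metric_bilinear)
    also have "\<dots> \<le> (\<Sum>i\<in>UNIV. \<Sum>j\<in>UNIV. (norm v)\<^sup>2 * \<bar>b (axis i 1) (axis j 1)\<bar>)"
    proof (intro sum_mono)
      fix i j
      have "\<bar>v $ i\<bar> * \<bar>v $ j\<bar> * \<bar>g c ?p (axis i 1) (axis j 1)\<bar> \<le> (norm v * norm v) * \<bar>b (axis i 1) (axis j 1)\<bar>"
        using b[OF x, of "axis i 1" "axis j 1"]
        by (intro mult_mono component_le_norm_cart) auto
      then show "v $ i * v $ j * g c ?p (axis i 1) (axis j 1) \<le> (norm v)\<^sup>2 * \<bar>b (axis i 1) (axis j 1)\<bar>"
        unfolding abs_mult[symmetric] power2_eq_square by linarith
    qed
    also have "\<dots> = ?b * (norm v)\<^sup>2" by (simp add: sum_distrib_left mult.commute)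
    also have "\<dots> \<le> (?b + 1) * (norm v)\<^sup>2" by (intro mult_right_mono) auto
    finally show ?thesis by (metis real_sqrt_le_mono real_sqrt_mult real_sqrt_abs abs_norm_cancel)
  qed
  moreover have "sqrt (?b + 1) > 0" using b0 by simp
  ultimately show ?thesis using that by blast
qed

text \<open>Straight coordinate segments serve as test curves for the distance. The derivative is
  needed in every chart \<open>d\<close> of the atlas, because the speed is computed in a chart
  chosen by \<open>chart_at\<close>.\<close>

lemma C1_curve_segment:
  fixes x v :: "real^'n"
  assumes seg: "\<And>t. t \<in> {0..1} \<Longrightarrow> x + t *\<^sub>R v \<in> snd c ` fst c"
  defines "\<gamma> \<equiv> \<lambda>t. chart_inv c (x + t *\<^sub>R v)"
  shows "piecewise_C1_curve A \<gamma>"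
    and "d \<in> A \<Longrightarrow> t \<in> {0..1} \<Longrightarrow> \<gamma> t \<in> fst d \<Longrightarrow> ((snd d \<circ> \<gamma>) has_vector_derivative
      frechet_derivative (transition c d) (at (x + t *\<^sub>R v)) v) (at t)"
proof -
  note ch = smooth_atlasD(1)[OF A c]
  let ?l = "\<lambda>t. x + t *\<^sub>R v"
  have \<gamma>c: "\<gamma> t \<in> fst c" "snd c (\<gamma> t) = ?l t" if "t \<in> {0..1}" for t
    unfolding \<gamma>_def using chart_inv_mem[OF ch seg[OF that]] chart_inv_right[OF ch seg[OF that]] by auto
  have mem: "?l t \<in> snd c ` (fst c \<inter> fst d)" if "t \<in> {0..1}" "\<gamma> t \<in> fst d" for t d
    using \<gamma>c[OF that(1)] that(2) by (metis IntI imageI)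
  have cont: "continuous_on {0..1} \<gamma>"
    unfolding \<gamma>_def
    by (rule continuous_on_compose2[OF continuous_on_chart_inv[OF ch]])
       (use seg in \<open>auto intro!: continuous_intros\<close>)
  show deriv: "((snd d \<circ> \<gamma>) has_vector_derivative
      frechet_derivative (transition c d) (at (?l t)) v) (at t)"
    if "d \<in> A" "t \<in> {0..1}" "\<gamma> t \<in> fst d" for d t
  proof -
    have "(transition c d has_derivative frechet_derivative (transition c d) (at (?l t))) (at (?l t))"
      using Ck_on_1D(1)[OF smooth_atlasD(3)[OF A c \<open>d \<in> A\<close>]] mem that by blast
    moreover have "(?l has_vector_derivative v) (at t)"
      by (auto intro!: derivative_eq_intros)
    ultimately have "((transition c d \<circ> ?l) has_vector_derivative
        frechet_derivative (transition c d) (at (?l t)) v) (at t)"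
      by (intro vector_derivative_diff_chain_within[where S = UNIV, simplified])
         (auto intro: has_derivative_at_withinI)
    \<comment> \<open>This equality of total functions holds also for \<open>t\<close> outside the
      unit interval, so the derivative is two-sided even at the end points.\<close>
    moreover have "transition c d \<circ> ?l = snd d \<circ> \<gamma>" by (auto simp: transition_def \<gamma>_def)
    ultimately show ?thesis by simp
  qed
  have "C1_curve_on A a b \<gamma>" if ab: "0 \<le> a" "b \<le> 1" for a b
    unfolding C1_curve_on_def
  proof (intro conjI ballI)
    show "continuous_on {a..b} \<gamma>" by (rule continuous_on_subset[OF cont]) (use ab in auto)
    fix d assume d: "d \<in> A"
    let ?\<gamma>' = "\<lambda>t. frechet_derivative (transition c d) (at (?l t)) v"
    have "\<forall>t\<in>{a..b} \<inter> \<gamma> -` fst d. ((snd d \<circ> \<gamma>) has_vector_derivative ?\<gamma>' t) (at t within {a..b})"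
      using deriv[OF d] ab by (auto intro: has_vector_derivative_at_within)
    moreover have "continuous_on ({a..b} \<inter> \<gamma> -` fst d) ?\<gamma>'"
      by (rule continuous_on_compose2[OF Ck_on_1D(2)[OF smooth_atlasD(3)[OF A c d]], where f = ?l])
         (use mem ab in \<open>auto intro!: continuous_intros\<close>)
    ultimately show "\<exists>\<gamma>'. (\<forall>t\<in>{a..b} \<inter> \<gamma> -` fst d.
        ((snd d \<circ> \<gamma>) has_vector_derivative \<gamma>' t) (at t within {a..b})) \<and>
        continuous_on ({a..b} \<inter> \<gamma> -` fst d) \<gamma>'" by (intro exI[of _ ?\<gamma>'] conjI)
  qed
  then show "piecewise_C1_curve A \<gamma>"
    unfolding piecewise_C1_curve_def using cont by (auto intro: exI[of _ "{}"])
qed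

text \<open>The distance is at most the length of the coordinate segment, whose speed, computed in
  whichever chart \<open>chart_at\<close> selects, is carried back to \<open>c\<close> by the
  transformation law of the metric. Bounding a Hausdorff dimension from above takes only upper
  bounds on distances.\<close>

lemma riemannian_dist_le:
  assumes K: "convex K" "K \<subseteq> snd c ` fst c"
    and B: "\<And>x v. x \<in> K \<Longrightarrow> sqrt (g c (chart_inv c x) v v) \<le> B * norm v"
    and pq: "p \<in> fst c" "q \<in> fst c" "snd c p \<in> K" "snd c q \<in> K"
  shows "riemannian_dist A g p q \<le> ennreal (B * norm (snd c p - snd c q))"
proof -
  note ch = smooth_atlasD(1)[OF A c]
  let ?x = "snd c p" and ?v = "snd c q - snd c p"
  define \<gamma> where "\<gamma> t = chart_inv c (?x + t *\<^sub>R ?v)" for t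
  have segK: "?x + t *\<^sub>R ?v \<in> K" if "t \<in> {0..1}" for t
  proof -
    have "?x + t *\<^sub>R ?v = (1 - t) *\<^sub>R ?x + t *\<^sub>R snd c q" by (simp add: algebra_simps)
    then show ?thesis using convexD_alt[OF K(1) pq(3,4)] that by auto
  qed
  then have seg: "?x + t *\<^sub>R ?v \<in> snd c ` fst c" if "t \<in> {0..1}" for t using K(2) that by blast
  have speed: "curve_speed A g \<gamma> t \<le> B * norm ?v" if t: "t \<in> {0..1}" for t
  proof -
    let ?d = "chart_at A (\<gamma> t)"
    have d: "?d \<in> A" "\<gamma> t \<in> fst ?d"
      using someI_ex[of "\<lambda>d. d \<in> A \<and> \<gamma> t \<in> fst d"] smooth_atlasD(2)[OF A]
      unfolding chart_at_def by blast+
    have \<gamma>t: "\<gamma> t \<in> fst c" "snd c (\<gamma> t) = ?x + t *\<^sub>R ?v"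
      unfolding \<gamma>_def using chart_inv_mem[OF ch seg[OF t]] chart_inv_right[OF ch seg[OF t]] by auto
    have "vector_derivative (snd ?d \<circ> \<gamma>) (at t)
        = frechet_derivative (transition c ?d) (at (snd c (\<gamma> t))) ?v"
      unfolding \<gamma>t(2)
      by (rule vector_derivative_at)
         (use C1_curve_segment(2)[OF seg d(1) t] d(2) in \<open>simp add: \<gamma>_def[abs_def]\<close>)
    then have "curve_speed A g \<gamma> t = sqrt (g c (\<gamma> t) ?v ?v)"
      unfolding curve_speed_def Let_def by (simp add: metric_transform[OF d(1) \<gamma>t(1) d(2)])
    also have "\<dots> \<le> B * norm ?v" unfolding \<gamma>_def using B[OF segK[OF t]] .
    finally show ?thesis .
  qed
  have "riemannian_dist A g p q \<le> curve_length A g \<gamma>"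
    unfolding riemannian_dist_def
  proof (rule INF_lower)
    have "piecewise_C1_curve A \<gamma>" using C1_curve_segment(1)[OF seg] by (simp add: \<gamma>_def[abs_def])
    then show "\<gamma> \<in> {\<gamma>. piecewise_C1_curve A \<gamma> \<and> \<gamma> 0 = p \<and> \<gamma> 1 = q}"
      using pq by (simp add: \<gamma>_def chart_inv_left[OF ch])
  qed
  also have "\<dots> \<le> (\<integral>\<^sup>+ t\<in>{0..1::real}. ennreal (B * norm ?v) \<partial>lborel)"
    unfolding curve_length_def
    by (intro nn_integral_mono) (auto split: split_indicator intro!: ennreal_leI speed)
  also have "\<dots> = ennreal (B * norm ?v)" by (simp add: nn_integral_cmult_indicator)
  finally show ?thesis by (simp add: norm_minus_commute)
qed

lemma riemannian_volume_lower_bound: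
  assumes Leb: "riemannian_volume A g Leb"
    and Q: "open Q" "Q \<subseteq> K" "K \<subseteq> snd c ` fst c"
    and a: "\<And>x. x \<in> K \<Longrightarrow> a \<le> volume_density g c x"
  shows "ennreal a * emeasure lborel Q \<le> emeasure Leb (fst c \<inter> snd c -` Q)"
proof -
  note ch = smooth_atlasD(1)[OF A c]
  let ?E = "fst c \<inter> snd c -` Q"
  have E: "?E \<in> sets borel" "snd c ` ?E = Q"
    using open_chart_vimage[OF ch Q(1)] Q(2,3) by auto
  have "ennreal a * emeasure lborel Q = (\<integral>\<^sup>+ x\<in>Q. ennreal a \<partial>lborel)"
    using Q(1) by (simp add: nn_integral_cmult_indicator)
  also have "\<dots> \<le> (\<integral>\<^sup>+ x\<in>Q. ennreal (volume_density g c x) \<partial>lborel)"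
    using a Q(2) by (intro nn_integral_mono) (auto split: split_indicator intro!: ennreal_leI)
  also have "\<dots> = emeasure Leb ?E"
    using Leb c E unfolding riemannian_volume_def by (metis inf_le1)
  finally show ?thesis .
qed

end

subsection \<open>Covering the deviation sets by cubes\<close>

text \<open>Cubes of the lattice of mesh \<open>q\<close> are used in an open and a closed version:
  the open ones are pairwise disjoint, as the volume count requires, and the closed ones cover the
  whole space.\<close>

definition grid_box :: "real \<Rightarrow> int^'n \<Rightarrow> (real^'n) set" where
  "grid_box q k = box (\<chi> j. of_int (k $ j) * q) (\<chi> j. (of_int (k $ j) + 1) * q)"

definition grid_cbox :: "real \<Rightarrow> int^'n \<Rightarrow> (real^'n) set" where
  "grid_cbox q k = cbox (\<chi> j. of_int (k $ j) * q) (\<chi> j. (of_int (k $ j) + 1) * q)"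

lemma grid_box_subset_cbox: "grid_box q k \<subseteq> grid_cbox q k"
  unfolding grid_box_def grid_cbox_def by (rule box_subset_cbox)

lemma mem_grid_cbox_floor:
  assumes "q > 0"
  shows "x \<in> grid_cbox q (\<chi> j. \<lfloor>x $ j / q\<rfloor>)"
proof -
  have "of_int \<lfloor>x $ j / q\<rfloor> * q \<le> x $ j / q * q" "x $ j / q * q \<le> (of_int \<lfloor>x $ j / q\<rfloor> + 1) * q" for j
    using assms by (intro mult_right_mono; linarith)+
  then have "of_int \<lfloor>x $ j / q\<rfloor> * q \<le> x $ j \<and> x $ j \<le> (of_int \<lfloor>x $ j / q\<rfloor> + 1) * q" for j
    using assms by simp
  then show ?thesis unfolding grid_cbox_def by (simp add: mem_box_cart)
qed

text \<open>The norm is bounded by the sum of the coordinate differences. The factor is cruder than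
  the square root of the dimension, but affects only constants.\<close>

lemma grid_cbox_norm:
  fixes x y :: "real^'n"
  assumes "x \<in> grid_cbox q k" "y \<in> grid_cbox q k"
  shows "norm (x - y) \<le> real CARD('n) * q"
proof -
  have "\<bar>(x - y) $ j\<bar> \<le> q" for j
  proof -
    have "of_int (k $ j) * q \<le> x $ j" "x $ j \<le> (of_int (k $ j) + 1) * q"
      "of_int (k $ j) * q \<le> y $ j" "y $ j \<le> (of_int (k $ j) + 1) * q"
      using assms unfolding grid_cbox_def mem_box_cart by simp_all
    then show ?thesis by (simp add: algebra_simps abs_le_iff)
  qed
  then have "(\<Sum>j\<in>UNIV. \<bar>(x - y) $ j\<bar>) \<le> (\<Sum>j\<in>(UNIV :: 'n set). q)" by (intro sum_mono)
  then show ?thesis using norm_le_l1_cart[of "x - y"] by simp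
qed

lemma disjoint_grid_box:
  fixes k k' :: "int^'n"
  assumes "q > 0" "x \<in> grid_box q k" "x \<in> grid_box q k'"
  shows "k = k'"
proof -
  have "k $ j = k' $ j" for j
  proof -
    have "of_int (k $ j) * q < x $ j" "x $ j < (of_int (k $ j) + 1) * q"
      "of_int (k' $ j) * q < x $ j" "x $ j < (of_int (k' $ j) + 1) * q"
      using assms(2,3) unfolding grid_box_def mem_box_cart by simp_all
    then have "of_int (k $ j) * q < (of_int (k' $ j) + 1) * q" "of_int (k' $ j) * q < (of_int (k $ j) + 1) * q"
      by linarith+
    then have "real_of_int (k $ j) < of_int (k' $ j) + 1" "real_of_int (k' $ j) < of_int (k $ j) + 1"
      using assms(1) by (simp_all only: mult_less_cancel_right_pos)
    then show ?thesis by linarith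
  qed
  then show ?thesis by (simp add: vec_eq_iff)
qed

lemma emeasure_grid_box:
  fixes k :: "int^'n"
  assumes "q > 0"
  shows "emeasure lborel (grid_box q k) = ennreal (q ^ CARD('n))"
proof -
  let ?l = "\<chi> j. of_int (k $ j) * q" and ?u = "\<chi> j. (of_int (k $ j) + 1) * q"
  have *: "(?u - ?l) \<bullet> b = q" if b: "b \<in> Basis" for b
  proof -
    obtain i where "b = axis i 1" using b unfolding Basis_vec_def by auto
    then show ?thesis by (simp add: inner_axis algebra_simps)
  qed
  have "?l \<bullet> b \<le> ?u \<bullet> b" if "b \<in> Basis" for b
    using *[OF that] assms by (simp add: inner_diff_left)
  then have "emeasure lborel (grid_box q k) = ennreal (\<Prod>b\<in>Basis. (?u - ?l) \<bullet> b)"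
    unfolding grid_box_def by (rule emeasure_lborel_box)
  also have "(\<Prod>b\<in>Basis. (?u - ?l) \<bullet> b) = (\<Prod>b\<in>(Basis :: (real^'n) set). q)"
    using * by (rule prod.cong[OF refl])
  finally show ?thesis by simp
qed

text \<open>Disjoint cubes inside \<open>Y\<close>, each of volume at least
  \<open>a * q ^ CARD('n)\<close>, cannot exceed the volume of \<open>Y\<close>. Counting with
  \<open>count_space\<close> in \<open>ennreal\<close> makes it unnecessary to know beforehand that
  \<open>J\<close> is finite.\<close>

lemma grid_count_bound:
  fixes A :: "('a::topological_space, 'n::finite) chart set" and J :: "(int^'n) set"
  assumes A: "smooth_atlas A" and g: "riemannian_metric A g" and c: "c \<in> A"
    and Leb: "riemannian_volume A g Leb"
    and K: "K \<subseteq> snd c ` fst c"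
    and a: "a > 0" "\<And>x. x \<in> K \<Longrightarrow> a \<le> volume_density g c x"
    and q: "q > 0"
    and J: "\<And>k. k \<in> J \<Longrightarrow> grid_box q k \<subseteq> K" "\<And>k. k \<in> J \<Longrightarrow> fst c \<inter> snd c -` grid_box q k \<subseteq> Y"
    and Y: "Y \<in> sets borel"
  shows "ennreal (a * q ^ CARD('n)) * emeasure (count_space UNIV) J \<le> emeasure Leb Y"
proof -
  note ch = smooth_atlasD(1)[OF A c]
  let ?E = "\<lambda>k. fst c \<inter> snd c -` grid_box q k"
  have sets: "sets Leb = sets borel" using Leb unfolding riemannian_volume_def by blast
  have E: "?E k \<in> sets Leb" for k
    unfolding sets grid_box_def by (intro borel_open open_chart_vimage[OF ch] open_box)
  have "ennreal (a * q ^ CARD('n)) * emeasure (count_space UNIV) J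
      = (\<integral>\<^sup>+k. ennreal (a * q ^ CARD('n)) * indicator J k \<partial>count_space UNIV)"
    by (simp add: nn_integral_cmult_indicator)
  also have "\<dots> = (\<integral>\<^sup>+k. ennreal (a * q ^ CARD('n)) \<partial>count_space J)"
    by (subst nn_integral_count_space_indicator) auto
  also have "\<dots> \<le> (\<integral>\<^sup>+k. emeasure Leb (?E k) \<partial>count_space J)"
  proof (rule nn_integral_mono)
    fix k assume "k \<in> space (count_space J)"
    then have k: "k \<in> J" by simp
    have "ennreal (a * q ^ CARD('n)) = ennreal a * emeasure lborel (grid_box q k)"
      using a q by (simp add: emeasure_grid_box[OF q] ennreal_mult)
    also have "\<dots> \<le> emeasure Leb (?E k)"
      by (rule riemannian_volume_lower_bound[OF A g c Leb _ J(1)[OF k] K a(2)])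
         (auto simp: grid_box_def)
    finally show "ennreal (a * q ^ CARD('n)) \<le> emeasure Leb (?E k)" .
  qed
  also have "\<dots> = emeasure Leb (\<Union>k\<in>J. ?E k)"
    by (rule emeasure_UN_countable[symmetric])
       (use E disjoint_grid_box[OF q] in \<open>auto simp: disjoint_family_on_def\<close>)
  also have "\<dots> \<le> emeasure Leb Y"
    using J(2) Y sets by (intro emeasure_mono) auto
  finally show ?thesis .
qed

section \<open>Birkhoff averages and deviation sets\<close>

lemma birkhoff_avg_close:
  assumes "\<And>k. k < n \<Longrightarrow> \<bar>\<phi> ((f ^^ k) x) - \<phi> ((f ^^ k) y)\<bar> \<le> \<epsilon>" "\<epsilon> \<ge> 0"
  shows "\<bar>birkhoff_avg f \<phi> n x - birkhoff_avg f \<phi> n y\<bar> \<le> \<epsilon>"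
\<comment> \<open>For \<open>n = 0\<close> both averages are 0, and the claim reduces to
  \<open>\<epsilon> \<ge> 0\<close>.\<close>
proof (cases "n = 0")
  case False
  have "\<bar>\<Sum>k<n. \<phi> ((f ^^ k) x) - \<phi> ((f ^^ k) y)\<bar> \<le> (\<Sum>k<n. \<epsilon>)"
    using assms(1) by (intro order_trans[OF sum_abs] sum_mono) auto
  then show ?thesis
    using False unfolding birkhoff_avg_def
    by (simp add: sum_subtractf diff_divide_distrib[symmetric] field_simps)
qed (use assms in \<open>simp add: birkhoff_avg_def\<close>)

text \<open>Supplies the Borel measurability that the volume count asks of \<open>Y\<close>.\<close>

lemma closed_deviation_set:
  assumes f: "continuous_on UNIV f" and \<phi>: "continuous_on UNIV \<phi>"
  shows "closed (deviation_set f \<mu> \<alpha> \<phi> n)"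
proof -
  have "continuous_on UNIV (f ^^ k)" for k
  proof (induction k)
    case (Suc k)
    then show ?case
      using continuous_on_compose2[OF f Suc] by (simp add: o_def)
  qed (simp add: id_def)
  then have "continuous_on UNIV (\<lambda>x. birkhoff_avg f \<phi> n x)"
    unfolding birkhoff_avg_def divide_inverse
    by (intro continuous_on_mult continuous_on_const continuous_on_sum continuous_on_compose2[OF \<phi>]) auto
  then show ?thesis
    unfolding deviation_set_def by (intro closed_Collect_le continuous_intros)
qed

text \<open>A limit superior above \<open>\<alpha>\<close> excludes that all late terms are below
  \<open>\<alpha>\<close>. The freedom in \<open>m\<close> lets the covers start at arbitrarily late
  times, where the cubes are small.\<close>

lemma limsup_deviation_frequently:
  assumes "x \<in> limsup_deviation_set f \<mu> \<alpha> \<phi>"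
  shows "\<exists>n\<ge>m. x \<in> deviation_set f \<mu> \<alpha> \<phi> n"
proof (rule ccontr)
  let ?D = "\<lambda>n. \<bar>birkhoff_avg f \<phi> n x - (\<integral>y. \<phi> y \<partial>\<mu>)\<bar>"
  assume "\<not> ?thesis"
  then have "\<forall>n\<ge>m. ereal (?D n) \<le> ereal \<alpha>" by (force simp: deviation_set_def)
  then have "\<forall>\<^sub>F n in sequentially. ereal (?D n) \<le> ereal \<alpha>"
    unfolding eventually_sequentially by blast
  then have "limsup (\<lambda>n. ereal (?D n)) \<le> ereal \<alpha>" by (rule Limsup_bounded)
  then show False using assms by (simp add: limsup_deviation_set_def)
qed

text \<open>The local form of the estimate. At time \<open>n\<close> the cubes of side
  \<open>q n\<close> that meet the deviation set in \<open>W\<close> consist of points with an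
  \<open>\<alpha>/2\<close>-deviation, so the volume bound limits their number; the condition on
  \<open>s\<close> makes their s-dimensional sums a geometric series. The constants found inside the
  proof may depend on \<open>p\<close>, while \<open>s\<close> is given.\<close>

lemma limsup_deviation_locally_null:
  fixes A :: "('a::topological_space, 'n::finite) chart set" and \<phi> :: "'a \<Rightarrow> real"
  assumes A: "smooth_atlas A" and g: "riemannian_metric A g" and Leb: "riemannian_volume A g Leb"
    and cont: "continuous_on UNIV f" "continuous_on UNIV \<phi>"
    and \<alpha>: "\<alpha> > 0" and L: "L > 1" and r: "r > 0" and h: "h > 0" and C: "C > 0"
    and ld: "\<And>n. n \<ge> 1 \<Longrightarrow>
      emeasure Leb (deviation_set f \<mu> (\<alpha>/2) \<phi> n \<inter> U) \<le> ennreal (C * exp (- (real n * h)))"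
    and U: "open U" "p \<in> U"
    and V: "c \<in> A" "open V" "p \<in> V" "V \<subseteq> fst c"
      "\<And>n k x y. x \<in> V \<Longrightarrow> y \<in> V \<Longrightarrow> norm (snd c x - snd c y) * L ^ n \<le> r \<Longrightarrow> k \<le> n \<Longrightarrow>
          \<bar>\<phi> ((f ^^ k) x) - \<phi> ((f ^^ k) y)\<bar> \<le> \<alpha>/2"
    and s: "s > 0" "(real CARD('n) - s) * ln L < h"
  shows "\<exists>W. open W \<and> p \<in> W \<and>
    hausdorff_measure (riemannian_dist A g) s (limsup_deviation_set f \<mu> \<alpha> \<phi> \<inter> W) = 0"
proof -
  note ch = smooth_atlasD(1)[OF A V(1)]
  let ?N = "real CARD('n)" and ?d = "riemannian_dist A g"
  have N: "?N \<ge> 1" by (simp add: Suc_leI)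
  have "open (snd c ` (V \<inter> U))" "snd c p \<in> snd c ` (V \<inter> U)"
    using V U by (auto intro!: open_chart_image[OF ch])
  then obtain t2 where "t2 > 0" "cball (snd c p) t2 \<subseteq> snd c ` (V \<inter> U)"
    using open_contains_cball by blast
  \<comment> \<open>\<open>W\<close> will have coordinate radius \<open>t\<close> and
    \<open>K\<close> has radius \<open>2 * t\<close>, so a cube of diameter at most \<open>t\<close>
    that meets \<open>W\<close> stays inside \<open>K\<close>, hence over \<open>V\<close> and
    \<open>U\<close>.\<close>
  define t where "t = t2 / 2"
  define K where "K = cball (snd c p) (2 * t)"
  have t: "t > 0" and K: "K \<subseteq> snd c ` (V \<inter> U)" "K \<subseteq> snd c ` fst c" "compact K" "convex K"
    using \<open>t2 > 0\<close> \<open>cball _ _ \<subseteq> _\<close> V(4) by (auto simp: t_def K_def)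
  have KVU: "x \<in> V \<inter> U" if "x \<in> fst c" "snd c x \<in> K" for x
  proof -
    obtain z where "z \<in> V \<inter> U" "snd c x = snd c z" using K(1) \<open>snd c x \<in> K\<close> by blast
    then show ?thesis using inj_onD[OF chart_inj[OF ch]] that(1) V(4) by blast
  qed
  obtain a where a: "a > 0" "\<And>x. x \<in> K \<Longrightarrow> a \<le> volume_density g c x"
    by (rule volume_density_lower_bound[OF A g V(1) K(3,2)]) (rule that)
  obtain B where B: "B > 0" "\<And>x v. x \<in> K \<Longrightarrow> sqrt (g c (chart_inv c x) v v) \<le> B * norm v"
    by (rule metric_upper_bound[OF A g V(1) K(3,2)]) (rule that)
  define W where "W = chart_ball c p t"
  have W: "open W" "p \<in> W" using open_chart_ball[OF ch] V(3,4) t by (auto simp: W_def chart_ball_def)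
  \<comment> \<open>Points of a cube of side \<open>q n\<close> have distance at most
    \<open>?N * q n\<close>, which equals \<open>r / L ^ n\<close> with this choice: exactly the
    scale at which orbits stay close up to time \<open>n\<close>.\<close>
  define \<rho> where "\<rho> = r / ?N"
  define q where "q n = \<rho> / L ^ n" for n
  have \<rho>: "\<rho> > 0" using r N by (simp add: \<rho>_def)
  have q: "q n > 0" for n using \<rho> L by (simp add: q_def)
  define J where "J n = {k. \<exists>x\<in>deviation_set f \<mu> \<alpha> \<phi> n \<inter> W. snd c x \<in> grid_cbox (q n) k}" for n
  \<comment> \<open>Empty sets outside \<open>J n\<close> allow summing over all lattice
    indices.\<close>
  define S where "S n k = (if k \<in> J n then fst c \<inter> snd c -` grid_cbox (q n) k else {})" for n k
  \<comment> \<open>The ratio of the geometric series: volume decay per time step against the factor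
    that refining the mesh by \<open>L\<close> costs. It is below 1 exactly when
    \<open>(?N - s) * ln L < h\<close>.\<close>
  define \<theta> where "\<theta> = exp (- h) * L powr (?N - s)"
  \<comment> \<open>The time-independent factors: \<open>C\<close> from the volume bound,
    \<open>(B * ?N) powr s\<close> from the diameters, and the rest from dividing by the cube volume
    \<open>a * q n ^ CARD('n)\<close>.\<close>
  define M where "M = C * (B * ?N) powr s * \<rho> powr (s - ?N) / a"
  have \<theta>: "0 < \<theta>" "\<theta> < 1"
  proof -
    have "\<theta> = exp (- h + (?N - s) * ln L)" unfolding \<theta>_def exp_add using L by (simp add: powr_def)
    then show "0 < \<theta>" "\<theta> < 1" using s(2) by simp_all
  qed
  have M: "M \<ge> 0" using C a by (simp add: M_def)
  have cube_K: "grid_cbox (q n) k \<subseteq> K" if "k \<in> J n" "?N * q n \<le> t" for n k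
  proof
    fix z assume z: "z \<in> grid_cbox (q n) k"
    obtain x where x: "x \<in> W" "snd c x \<in> grid_cbox (q n) k" using \<open>k \<in> J n\<close> by (auto simp: J_def)
    have "dist (snd c x) z \<le> t" using grid_cbox_norm[OF x(2) z] that(2) by (simp add: dist_norm)
    moreover have "dist (snd c p) (snd c x) < t" using x(1) by (simp add: W_def chart_ball_def)
    ultimately show "z \<in> K" using dist_triangle[of "snd c p" z "snd c x"] by (simp add: K_def)
  qed
  have cube_dev: "y \<in> deviation_set f \<mu> (\<alpha>/2) \<phi> n \<inter> U"
    if k: "k \<in> J n" "?N * q n \<le> t" and y: "y \<in> fst c" "snd c y \<in> grid_cbox (q n) k" for n k y
  proof -
    obtain x where x: "x \<in> W" "x \<in> deviation_set f \<mu> \<alpha> \<phi> n" "snd c x \<in> grid_cbox (q n) k"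
      using k(1) by (auto simp: J_def)
    have "x \<in> fst c" using x(1) by (simp add: W_def chart_ball_def)
    then have xy: "x \<in> V" "y \<in> V" "y \<in> U" using KVU cube_K[OF k] x(3) y by blast+
    have "norm (snd c x - snd c y) * L ^ n \<le> (?N * q n) * L ^ n"
      using grid_cbox_norm[OF x(3) y(2)] L by (intro mult_right_mono) auto
    also have "\<dots> = r" using N L by (simp add: q_def \<rho>_def)
    finally have "\<bar>birkhoff_avg f \<phi> n x - birkhoff_avg f \<phi> n y\<bar> \<le> \<alpha>/2"
      using V(5)[OF xy(1,2)] \<alpha> by (intro birkhoff_avg_close) auto
    then have "\<alpha>/2 \<le> \<bar>birkhoff_avg f \<phi> n y - (\<integral>y. \<phi> y \<partial>\<mu>)\<bar>"
      using x(2) unfolding deviation_set_def mem_Collect_eq by linarith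
    then show ?thesis using xy(3) by (simp add: deviation_set_def)
  qed
  have diam_S: "diam ?d (S n k) \<le> ennreal (B * (?N * q n))" if n: "?N * q n \<le> t" for n k
  proof (cases "k \<in> J n")
    case True
    show ?thesis
      unfolding diam_def
    proof (intro SUP_least)
      fix x y assume "x \<in> S n k" "y \<in> S n k"
      then have xy: "x \<in> fst c" "y \<in> fst c" "snd c x \<in> grid_cbox (q n) k" "snd c y \<in> grid_cbox (q n) k"
        using True by (auto simp: S_def)
      then have "?d x y \<le> ennreal (B * norm (snd c x - snd c y))"
        using cube_K[OF True n] by (intro riemannian_dist_le[OF A g V(1) K(4,2) B(2)]) auto
      also have "\<dots> \<le> ennreal (B * (?N * q n))"
        using grid_cbox_norm[OF xy(3,4)] B(1) by (intro ennreal_leI mult_left_mono) auto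
      finally show "?d x y \<le> ennreal (B * (?N * q n))" .
    qed
  qed (simp add: S_def diam_def bot_ennreal)
  have level: "(\<integral>\<^sup>+k. ennreal (enn2real (diam ?d (S n k)) powr s) \<partial>count_space UNIV) \<le> ennreal (M * \<theta> ^ n)"
    if n: "n \<ge> 1" "?N * q n \<le> t" for n
  proof -
    define w where "w = (B * (?N * q n)) powr s"
    define v where "v = a * q n ^ CARD('n)"
    have v: "v > 0" and w: "w \<ge> 0" using a(1) q[of n] by (simp_all add: v_def w_def)
    \<comment> \<open>The number of cubes is controlled only after multiplication by
      \<open>v\<close>, so \<open>w\<close> is factored through \<open>v\<close> instead of dividing
      in \<open>ennreal\<close>.\<close>
    have w_eq: "ennreal w = ennreal (w / v) * ennreal v"
      using v w by (subst ennreal_mult[symmetric]) simp_all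
    have count: "ennreal v * emeasure (count_space UNIV) (J n) \<le> ennreal (C * exp (- (real n * h)))"
    unfolding v_def
    proof (rule order_trans[OF grid_count_bound[OF A g V(1) Leb K(2) a q] ld[OF n(1)]])
      show "grid_box (q n) k \<subseteq> K" if "k \<in> J n" for k
        using grid_box_subset_cbox cube_K[OF that n(2)] by blast
      show "fst c \<inter> snd c -` grid_box (q n) k \<subseteq> deviation_set f \<mu> (\<alpha> / 2) \<phi> n \<inter> U" if "k \<in> J n" for k
        using grid_box_subset_cbox[of "q n" k] cube_dev[OF that n(2)] by blast
      show "deviation_set f \<mu> (\<alpha> / 2) \<phi> n \<inter> U \<in> sets borel"
        using closed_deviation_set[OF cont] U(1) by (intro sets.Int) auto
    qed
    have "(\<integral>\<^sup>+k. ennreal (enn2real (diam ?d (S n k)) powr s) \<partial>count_space UNIV)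
        \<le> (\<integral>\<^sup>+k. ennreal w * indicator (J n) k \<partial>count_space UNIV)"
    proof (rule nn_integral_mono)
      fix k
      show "ennreal (enn2real (diam ?d (S n k)) powr s) \<le> ennreal w * indicator (J n) k"
      proof (cases "k \<in> J n")
        case True
        have "enn2real (diam ?d (S n k)) \<le> B * (?N * q n)"
          using enn2real_mono[OF diam_S[OF n(2), of k]] B(1) N q[of n] by simp
        then show ?thesis using True s(1) by (auto simp: w_def intro!: ennreal_leI powr_mono2)
      qed (simp add: S_def diam_def bot_ennreal)
    qed
    also have "\<dots> = ennreal w * emeasure (count_space UNIV) (J n)"
      by (simp add: nn_integral_cmult_indicator)
    also have "\<dots> = ennreal (w / v) * (ennreal v * emeasure (count_space UNIV) (J n))"
      by (simp only: w_eq mult.assoc)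
    also have "\<dots> \<le> ennreal (w / v) * ennreal (C * exp (- (real n * h)))"
      using count by (intro mult_left_mono) auto
    also have "\<dots> = ennreal (w / v * (C * exp (- (real n * h))))"
      using v w C by (intro ennreal_mult[symmetric]) auto
    also have "w / v * (C * exp (- (real n * h))) = M * \<theta> ^ n"
    proof -
      let ?T = "L powr (?N - s)"
      have "w = (B * ?N) powr s * q n powr s"
        unfolding w_def mult.assoc[symmetric] by (rule powr_mult)
      then have "w / v = (B * ?N) powr s / a * (q n powr s / q n ^ CARD('n))"
        by (simp add: v_def)
      also have "q n powr s / q n ^ CARD('n) = q n powr (s - ?N)"
        using q[of n] by (simp add: powr_diff powr_realpow)
      also have "\<dots> = \<rho> powr (s - ?N) * ?T ^ n"
      proof -
        have "q n powr (s - ?N) = \<rho> powr (s - ?N) / (L ^ n) powr (s - ?N)"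
          using \<rho> L unfolding q_def by (simp add: powr_divide)
        also have "(L ^ n) powr (s - ?N) = L powr (- (real n * (?N - s)))"
          using L by (simp add: powr_powr powr_realpow[symmetric] algebra_simps)
        also have "\<dots> = inverse (L powr (real n * (?N - s)))" by (rule powr_minus)
        also have "L powr (real n * (?N - s)) = ?T ^ n"
          using L by (simp add: powr_powr powr_realpow[symmetric] mult.commute)
        finally show ?thesis by (simp add: divide_inverse)
      qed
      finally have wv: "w / v = (B * ?N) powr s / a * (\<rho> powr (s - ?N) * ?T ^ n)" .
      have "exp (- (real n * h)) = exp (- h) ^ n"
        by (simp add: exp_of_nat_mult[symmetric])
      then show ?thesis
        unfolding wv M_def \<theta>_def power_mult_distrib by (simp only: divide_inverse mult_ac)
    qed
    finally show ?thesis .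
  qed
  have q0: "q \<longlonglongrightarrow> 0"
  proof -
    have "(\<lambda>n. \<rho> * (1 / L) ^ n) \<longlonglongrightarrow> 0"
      using L by (intro tendsto_mult_right_zero LIMSEQ_realpow_zero) auto
    then show ?thesis by (simp add: q_def[abs_def] power_divide)
  qed
  have "hausdorff_pre ?d s \<delta> (limsup_deviation_set f \<mu> \<alpha> \<phi> \<inter> W) = 0" if \<delta>: "\<delta> > 0" for \<delta>
  proof -
    have "hausdorff_pre ?d s \<delta> (limsup_deviation_set f \<mu> \<alpha> \<phi> \<inter> W) \<le> 0 + ennreal \<epsilon>" if \<epsilon>: "\<epsilon> > 0" for \<epsilon>
    proof -
      have "(\<lambda>n. ?N * q n) \<longlonglongrightarrow> 0" "(\<lambda>n. B * (?N * q n)) \<longlonglongrightarrow> 0" "(\<lambda>n. M * \<theta> ^ n / (1 - \<theta>)) \<longlonglongrightarrow> 0"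
        using q0 LIMSEQ_realpow_zero[of \<theta>] \<theta>
        by (auto intro!: tendsto_mult_right_zero tendsto_divide_zero)
      then have "\<forall>\<^sub>F n in sequentially. ?N * q n < t \<and> B * (?N * q n) < \<delta> \<and> M * \<theta> ^ n / (1 - \<theta>) < \<epsilon> \<and> n \<ge> 1"
        using t \<delta> \<epsilon> by (intro eventually_conj order_tendstoD(2) eventually_ge_at_top)
      \<comment> \<open>From time \<open>m\<close> on the cubes fit into \<open>K\<close> and have
        diameter below \<open>\<delta>\<close>, and the tail of the series is below
        \<open>\<epsilon>\<close>. The condition \<open>m \<ge> 1\<close> is there because the
        volume bound starts at time 1.\<close>
      then obtain m where m: "\<And>n. n \<ge> m \<Longrightarrow> ?N * q n < t" "\<And>n. n \<ge> m \<Longrightarrow> B * (?N * q n) < \<delta>"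
        "M * \<theta> ^ m / (1 - \<theta>) < \<epsilon>" "m \<ge> 1"
        unfolding eventually_sequentially by blast
      define T where "T = (\<lambda>(n, k). if n \<ge> m then S n k else {})"
      have diam_T: "diam ?d (T nk) \<le> ennreal \<delta>" for nk
      proof (cases nk)
        case (Pair n k)
        show ?thesis
        proof (cases "n \<ge> m")
          case True
          have "diam ?d (S n k) \<le> ennreal (B * (?N * q n))"
            using m(1)[OF True] by (intro diam_S) simp
          also have "\<dots> \<le> ennreal \<delta>" using m(2)[OF True] by (intro ennreal_leI) simp
          finally show ?thesis using True by (simp add: Pair T_def)
        qed (simp add: Pair T_def diam_def bot_ennreal)
      qed
      have cover: "limsup_deviation_set f \<mu> \<alpha> \<phi> \<inter> W \<subseteq> (\<Union>nk. T nk)"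
      proof
        fix x assume x: "x \<in> limsup_deviation_set f \<mu> \<alpha> \<phi> \<inter> W"
        then obtain n where n: "n \<ge> m" "x \<in> deviation_set f \<mu> \<alpha> \<phi> n"
          using limsup_deviation_frequently[of x f \<mu> \<alpha> \<phi> m] by blast
        let ?k = "\<chi> j. \<lfloor>snd c x $ j / q n\<rfloor>"
        have k: "snd c x \<in> grid_cbox (q n) ?k" by (rule mem_grid_cbox_floor[OF q])
        then have "?k \<in> J n" using n(2) x unfolding J_def by blast
        then have "x \<in> T (n, ?k)" using k n(1) x by (simp add: T_def S_def W_def chart_ball_def)
        then show "x \<in> (\<Union>nk. T nk)" by blast
      qed
      have "hausdorff_pre ?d s \<delta> (limsup_deviation_set f \<mu> \<alpha> \<phi> \<inter> W)
          \<le> (\<integral>\<^sup>+nk. ennreal (enn2real (diam ?d (T nk)) powr s) \<partial>count_space UNIV)"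
        by (rule hausdorff_pre_le_countable[OF cover diam_T])
      also have "\<dots> = (\<integral>\<^sup>+n. \<integral>\<^sup>+k. ennreal (enn2real (diam ?d (T (n, k))) powr s)
          \<partial>count_space UNIV \<partial>count_space UNIV)"
        by (rule nn_integral_fst_count_space[symmetric])
      also have "\<dots> \<le> (\<integral>\<^sup>+n. ennreal (if n \<ge> m then M * \<theta> ^ n else 0) \<partial>count_space UNIV)"
      proof (rule nn_integral_mono)
        fix n
        show "(\<integral>\<^sup>+k. ennreal (enn2real (diam ?d (T (n, k))) powr s) \<partial>count_space UNIV)
            \<le> ennreal (if n \<ge> m then M * \<theta> ^ n else 0)"
          using level[of n] m(1)[of n] m(4) by (auto simp: T_def diam_def bot_ennreal)
      qed
      also have "\<dots> = (\<Sum>n. ennreal (if n \<ge> m then M * \<theta> ^ n else 0))"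
        by (rule nn_integral_count_space_nat)
      also have "\<dots> = ennreal (M * \<theta> ^ m / (1 - \<theta>))"
      proof (rule suminf_ennreal_eq)
        have "(\<lambda>n. M * \<theta> ^ m * \<theta> ^ n) sums (M * \<theta> ^ m * (1 / (1 - \<theta>)))"
          using geometric_sums[of \<theta>] \<theta> by (intro sums_mult) auto
        \<comment> \<open>Shifted by \<open>m\<close>, the condition is always true; shifting back
          adds only the \<open>m\<close> vanishing initial terms.\<close>
        then have "(\<lambda>n. (if n + m \<ge> m then M * \<theta> ^ (n + m) else 0)) sums (M * \<theta> ^ m / (1 - \<theta>))"
          by (simp add: power_add mult_ac)
        then show "(\<lambda>n. if n \<ge> m then M * \<theta> ^ n else 0) sums (M * \<theta> ^ m / (1 - \<theta>))"
          by (subst (asm) sums_iff_shift) simp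
      qed (use M \<theta> in auto)
      also have "\<dots> \<le> ennreal \<epsilon>" using m(3) by (intro ennreal_leI) auto
      finally show ?thesis by simp
    qed
    then have "hausdorff_pre ?d s \<delta> (limsup_deviation_set f \<mu> \<alpha> \<phi> \<inter> W) \<le> 0" by (rule ennreal_le_epsilon)
    then show ?thesis by simp
  qed
  then show ?thesis using W unfolding hausdorff_measure_eq_0_iff by blast
qed

section \<open>Choice of the exponent and passage from local null sets to the dimension bound on
  \<open>U\<close>\<close>

theorem theorem1:
  fixes A :: "('a::{t2_space, second_countable_topology}, 'n::finite) chart set"
    and g :: "('a, 'n) metric_rep"
    and Leb \<mu> :: "'a measure"
    and f :: "'a \<Rightarrow> 'a"
    and U :: "'a set"
  assumes "compact (UNIV :: 'a set)"
    and "smooth_atlas A"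
    and "riemannian_metric A g"
    and "riemannian_volume A g Leb"
    and "C1_local_diffeo A f"
    and "trapping_domain f U"
    and "invariant_borel_prob f \<mu>"
    and "AE x in \<mu>. x \<in> U"
    and "large_deviations Leb f \<mu> U"
  shows "special_ergodic A g f \<mu> U"
  unfolding special_ergodic_def
proof (intro allI impI)
  fix \<phi> :: "'a \<Rightarrow> real" and \<alpha> :: real
  assume \<phi>: "continuous_on UNIV \<phi>" and \<alpha>: "\<alpha> > 0"
  let ?N = "real CARD('n)" and ?X = "limsup_deviation_set f \<mu> \<alpha> \<phi> \<inter> U"
  \<comment> \<open>Large deviations are applied with \<open>\<alpha>/2\<close>: the other half of
    \<open>\<alpha>\<close> is spent on moving from one point of a cube to another.\<close>
  obtain C h where C: "C > 0" "h > 0"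
    and ld: "\<And>n. n \<ge> 1 \<Longrightarrow>
      emeasure Leb (deviation_set f \<mu> (\<alpha>/2) \<phi> n \<inter> U) \<le> ennreal (C * exp (- (real n * h)))"
    using assms(9) \<phi> half_gt_zero[OF \<alpha>] unfolding large_deviations_def by meson
  obtain L r where L: "L > 1" "r > 0" and orb:
    "\<And>p. \<exists>c\<in>A. \<exists>V. open V \<and> p \<in> V \<and> V \<subseteq> fst c \<and>
       (\<forall>n k. \<forall>x\<in>V. \<forall>y\<in>V. norm (snd c x - snd c y) * L ^ n \<le> r \<longrightarrow> k \<le> n \<longrightarrow>
          \<bar>\<phi> ((f ^^ k) x) - \<phi> ((f ^^ k) y)\<bar> \<le> \<alpha>/2)"
    by (rule orbits_stay_close[OF assms(1,2,5) \<phi> half_gt_zero[OF \<alpha>]]) (rule that)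
  \<comment> \<open>The second entry of the minimum gives
    \<open>(?N - s) * ln L \<le> h / 2\<close>, which is below \<open>h\<close>; the entry
    \<open>1/2\<close> keeps \<open>s\<close> positive, as \<open>?N \<ge> 1\<close>.\<close>
  define s where "s = ?N - min (1/2) (h / (2 * ln L))"
  have lnL: "ln L > 0" using L by simp
  have N: "?N \<ge> 1" by (simp add: Suc_leI)
  have "0 < min (1/2) (h / (2 * ln L))" using lnL C by simp
  moreover have "min (1/2) (h / (2 * ln L)) \<le> 1/2" by simp
  ultimately have s: "0 < s" "s < ?N" using N unfolding s_def by linarith+
  have "(?N - s) * ln L \<le> h / (2 * ln L) * ln L"
    using lnL by (intro mult_right_mono) (auto simp: s_def)
  also have "\<dots> < h" using lnL C by simp
  finally have sL: "(?N - s) * ln L < h" .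
  \<comment> \<open>Charts and neighbourhoods vary with the point, but \<open>s\<close>,
    \<open>L\<close>, \<open>r\<close>, \<open>C\<close> and \<open>h\<close> are already fixed, so
    one exponent works at every point of \<open>U\<close>.\<close>
  have "hausdorff_measure (riemannian_dist A g) s ?X = 0"
  proof (rule hausdorff_measure_zero_local)
    fix p assume p: "p \<in> ?X"
    obtain c V where cV: "c \<in> A" "open V" "p \<in> V" "V \<subseteq> fst c"
       and orbV: "\<And>n k x y. x \<in> V \<Longrightarrow> y \<in> V \<Longrightarrow> norm (snd c x - snd c y) * L ^ n \<le> r \<Longrightarrow> k \<le> n \<Longrightarrow>
          \<bar>\<phi> ((f ^^ k) x) - \<phi> ((f ^^ k) y)\<bar> \<le> \<alpha>/2"
      using orb[of p] by blast
    have U: "open U" "p \<in> U" using assms(6) p by (auto simp: trapping_domain_def)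
    have "\<exists>W. open W \<and> p \<in> W \<and>
      hausdorff_measure (riemannian_dist A g) s (limsup_deviation_set f \<mu> \<alpha> \<phi> \<inter> W) = 0"
      by (rule limsup_deviation_locally_null[OF assms(2,3,4) C1_local_diffeo_continuous[OF assms(5)]
            \<phi> \<alpha> L C(2,1) _ U cV _ s(1) sL]) (fact ld, fact orbV)
    then obtain W where W: "open W" "p \<in> W"
      "hausdorff_measure (riemannian_dist A g) s (limsup_deviation_set f \<mu> \<alpha> \<phi> \<inter> W) = 0"
      by blast
    have "hausdorff_measure (riemannian_dist A g) s (?X \<inter> W) = 0"
      by (rule hausdorff_measure_zero_mono[OF W(3)]) auto
    then show "\<exists>W. open W \<and> p \<in> W \<and> hausdorff_measure (riemannian_dist A g) s (?X \<inter> W) = 0"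
      using W by blast
  qed
  then have "hausdorff_dim (riemannian_dist A g) ?X \<le> ennreal s"
    unfolding hausdorff_dim_def using s(1) by (intro INF_lower) auto
  also have "ennreal s < ennreal ?N" using s by (intro ennreal_lessI) auto
  finally show "hausdorff_dim (riemannian_dist A g) ?X < of_nat CARD('n)"
    by (simp add: ennreal_of_nat_eq_real_of_nat)
qed

end
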